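(* The ideal $(\Pi_2^N)_{N\in\mathbb{N}}$ of multiple $2$-summing forms is not dual to any associative tensor norm. That is, there is no associative tensor norm $\beta$ (of order $2$) such that for every $N\ge 2$ and all Banach spaces $X_1,\dots,X_N$ the space $\Pi_2^N(X_1\times\cdots\times X_N)$ is (via the canonical identification) isomorphic to the dual of the $N$-fold tensor product $X_1\otimes\cdots\otimes X_N$ endowed with $\beta$.
   Context: Multiple $p$-summing forms: let $1\le p<\infty$ and let $X_1,\dots,X_N$ be Banach spaces over $\mathbb{K}$. A continuous $N$-linear form $\Phi:X_1\times\cdots\times X_N\to\mathbb{K}$ is multiple $p$-summing if there is $K>0$ such that for all finite sequences $(x^j_{i_j})_{i_j=1}^{m_j}\subset X_j$, $j=1,\dots,N$, $$\Big(\sum_{i_1,\dots,i_N=1}^{m_1,\dots,m_N}|\Phi(x^1_{i_1},\dots,x^N_{i_N})|^p\Big)^{1/p}\le K\prod_{j=1}^N\|(x^j_{i_j})_{i_j=1}^{m_j}\|_p^w,$$ where $\|(x_i)_{i=1}^m\|_p^w=\sup_{x'\in B_{X'}}\big(\sum_{i=1}^m|x'(x_i)|^p\big)^{1/p}$. The least such $K$ is the norm $\pi_p(\Phi)$, and $\Pi_p^N(X_1\times\cdots\times X_N)$ is the space of multiple $p$-summing forms with this norm. Tensor norms: a tensor norm $\beta$ of order $2$ assigns to each pair of normed spaces $(E,F)$ a norm $\beta$ on $E\otimes F$ with $\varepsilon\le\beta\le\pi$ ($\varepsilon$ injective, $\pi$ projective norm) and with the metric mapping property $\|T_1\otimes T_2:E_1\otimes_\beta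 F_1\to E_2\otimes_\beta F_2\|\le\|T_1\|\|T_2\|$ for bounded operators $T_1:E_1\to E_2$, $T_2:F_1\to F_2$. $E\tilde\otimes_\beta F$ is the completion. $\beta$ is associative if $(E\otimes_\beta F)\otimes_\beta G$ and $E\otimes_\beta(F\otimes_\beta G)$ coincide under the canonical identification; then $\beta$ defines a norm on each $N$-fold tensor product $X_1\otimes\cdots\otimes X_N$ by iteration, independent of the bracketing (e.g. for $N=4$, $(X_1\tilde\otimes_\beta X_2)\tilde\otimes_\beta(X_3\tilde\otimes_\beta X_4)$). The canonical identification sends an $N$-linear form to its linearization on the tensor product; "isomorphic" means that the two spaces of forms coincide with equivalent norms. *)

theory Defs
  imports Complex_Main "HOL-Algebra.Module"
begin

section \<open>Normed and Banach spaces on a carrier\<close>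

text \<open>
  A tensor norm is a function on pairs of normed spaces, so normed spaces have to be values rather
  than types: they are modules over the ring of scalars (in the sense of HOL-Algebra) together with
  a norm.  The ring components \<^term>\<open>mult\<close> and \<^term>\<open>one\<close> inherited by the record play no role.
  The scalars are a type \<open>'k\<close>, later taken to be \<^typ>\<open>real\<close> and \<^typ>\<open>complex\<close>.
\<close>

record ('k, 'u) nspace = "('k, 'u) module" +
  nrm :: "'u \<Rightarrow> real"

definition scalar_ring :: "'k::real_normed_field ring" where
  "scalar_ring = \<lparr>carrier = UNIV, monoid.mult = (*), one = 1, ring.zero = 0, add = (+)\<rparr>"

definition normed_space :: "('k::real_normed_field, 'u) nspace \<Rightarrow> bool" where
  "normed_space E \<longleftrightarrow> module scalar_ring E
     \<and> (\<forall>x\<in>carrier E. 0 \<le> nrm E x \<and> (nrm E x = 0 \<longleftrightarrow> x = \<zero>\<^bsub>E\<^esub>))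
     \<and> (\<forall>c. \<forall>x\<in>carrier E. nrm E (c \<odot>\<^bsub>E\<^esub> x) = norm c * nrm E x)
     \<and> (\<forall>x\<in>carrier E. \<forall>y\<in>carrier E. nrm E (x \<oplus>\<^bsub>E\<^esub> y) \<le> nrm E x + nrm E y)"

definition banach_space :: "('k::real_normed_field, 'u) nspace \<Rightarrow> bool" where
  "banach_space E \<longleftrightarrow> normed_space E
     \<and> (\<forall>s::nat \<Rightarrow> 'u. (\<forall>n. s n \<in> carrier E)
          \<and> (\<forall>e>0. \<exists>M. \<forall>m\<ge>M. \<forall>n\<ge>M. nrm E (s m \<ominus>\<^bsub>E\<^esub> s n) < e)
          \<longrightarrow> (\<exists>x\<in>carrier E. (\<lambda>n. nrm E (s n \<ominus>\<^bsub>E\<^esub> x)) \<longlonglongrightarrow> 0))"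

text \<open>Operators and functionals are HOL functions; only their values on the carrier matter.\<close>

definition bounded_op :: "('k::real_normed_field, 'u) nspace \<Rightarrow> ('k, 'v) nspace \<Rightarrow> ('u \<Rightarrow> 'v) \<Rightarrow> bool" where
  "bounded_op E F T \<longleftrightarrow> T \<in> carrier E \<rightarrow> carrier F
     \<and> (\<forall>x\<in>carrier E. \<forall>y\<in>carrier E. T (x \<oplus>\<^bsub>E\<^esub> y) = T x \<oplus>\<^bsub>F\<^esub> T y)
     \<and> (\<forall>c. \<forall>x\<in>carrier E. T (c \<odot>\<^bsub>E\<^esub> x) = c \<odot>\<^bsub>F\<^esub> T x)
     \<and> (\<exists>C. \<forall>x\<in>carrier E. nrm F (T x) \<le> C * nrm E x)"

definition op_norm :: "('k::real_normed_field, 'u) nspace \<Rightarrow> ('k, 'v) nspace \<Rightarrow> ('u \<Rightarrow> 'v) \<Rightarrow> real" where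
  "op_norm E F T = (SUP x\<in>{x\<in>carrier E. nrm E x \<le> 1}. nrm F (T x))"

definition linear_functional :: "('k::real_normed_field, 'u) nspace \<Rightarrow> ('u \<Rightarrow> 'k) \<Rightarrow> bool" where
  "linear_functional E \<phi> \<longleftrightarrow>
     (\<forall>x\<in>carrier E. \<forall>y\<in>carrier E. \<phi> (x \<oplus>\<^bsub>E\<^esub> y) = \<phi> x + \<phi> y)
     \<and> (\<forall>c. \<forall>x\<in>carrier E. \<phi> (c \<odot>\<^bsub>E\<^esub> x) = c * \<phi> x)"

definition bounded_functional :: "('k::real_normed_field, 'u) nspace \<Rightarrow> ('u \<Rightarrow> 'k) \<Rightarrow> bool" where
  "bounded_functional E \<phi> \<longleftrightarrow> linear_functional E \<phi>
     \<and> (\<exists>C. \<forall>x\<in>carrier E. norm (\<phi> x) \<le> C * nrm E x)"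

definition dual_norm :: "('k::real_normed_field, 'u) nspace \<Rightarrow> ('u \<Rightarrow> 'k) \<Rightarrow> real" where
  "dual_norm E \<phi> = (SUP x\<in>{x\<in>carrier E. nrm E x \<le> 1}. norm (\<phi> x))"

definition dual_ball :: "('k::real_normed_field, 'u) nspace \<Rightarrow> ('u \<Rightarrow> 'k) set" where
  "dual_ball E = {\<phi>. bounded_functional E \<phi> \<and> dual_norm E \<phi> \<le> 1}"


section \<open>Multiple summing forms\<close>

text \<open>
  An \<open>N\<close>-linear form on \<open>X\<^sub>1, \<dots>, X\<^sub>N\<close> is a function on lists of length \<open>N\<close>; \<open>Xs\<close> is the
  list of spaces.  Continuity is expressed by boundedness, as in \<open>bounded_linear\<close> and
  \<open>bounded_bilinear\<close>.
\<close>

definition multilinear_form :: "('k::real_normed_field, 'u) nspace list \<Rightarrow> ('u list \<Rightarrow> 'k) \<Rightarrow> bool" where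
  "multilinear_form Xs \<Phi> \<longleftrightarrow>
     (\<forall>xs\<in>listset (map carrier Xs). \<forall>j<length Xs.
        (\<forall>u\<in>carrier (Xs ! j). \<forall>v\<in>carrier (Xs ! j).
           \<Phi> (xs[j := u \<oplus>\<^bsub>Xs ! j\<^esub> v]) = \<Phi> (xs[j := u]) + \<Phi> (xs[j := v]))
        \<and> (\<forall>c. \<forall>u\<in>carrier (Xs ! j). \<Phi> (xs[j := c \<odot>\<^bsub>Xs ! j\<^esub> u]) = c * \<Phi> (xs[j := u])))"

definition continuous_multilinear_form ::
    "('k::real_normed_field, 'u) nspace list \<Rightarrow> ('u list \<Rightarrow> 'k) \<Rightarrow> bool" where
  "continuous_multilinear_form Xs \<Phi> \<longleftrightarrow> multilinear_form Xs \<Phi>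
     \<and> (\<exists>C. \<forall>xs\<in>listset (map carrier Xs).
            norm (\<Phi> xs) \<le> C * (\<Prod>j<length Xs. nrm (Xs ! j) (xs ! j)))"

text \<open>The weak \<open>p\<close>-norm of the finite sequence \<open>x 0, \<dots>, x (m - 1)\<close>.\<close>

definition weak_norm :: "real \<Rightarrow> ('k::real_normed_field, 'u) nspace \<Rightarrow> nat \<Rightarrow> (nat \<Rightarrow> 'u) \<Rightarrow> real" where
  "weak_norm p E m x = (SUP \<phi>\<in>dual_ball E. (\<Sum>i<m. norm (\<phi> (x i)) powr p) powr (1 / p))"

text \<open>In the following, \<open>x j i\<close> is the \<open>i\<close>-th vector of the finite sequence of length \<open>m j\<close> in
  \<open>Xs ! j\<close>; the multi-index \<open>i\<close> ranges over the functions with \<open>i j < m j\<close>.\<close>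

definition summing_bound ::
    "real \<Rightarrow> ('k::real_normed_field, 'u) nspace list \<Rightarrow> ('u list \<Rightarrow> 'k) \<Rightarrow> real \<Rightarrow> bool" where
  "summing_bound p Xs \<Phi> K \<longleftrightarrow>
     (\<forall>(m :: nat \<Rightarrow> nat) (x :: nat \<Rightarrow> nat \<Rightarrow> 'u).
        (\<forall>j<length Xs. \<forall>i<m j. x j i \<in> carrier (Xs ! j)) \<longrightarrow>
        (\<Sum>i\<in>(\<Pi>\<^sub>E j\<in>{..<length Xs}. {..<m j}).
            norm (\<Phi> (map (\<lambda>j. x j (i j)) [0..<length Xs])) powr p) powr (1 / p)
          \<le> K * (\<Prod>j<length Xs. weak_norm p (Xs ! j) (m j) (x j)))"

definition multiple_summing ::
    "real \<Rightarrow> ('k::real_normed_field, 'u) nspace list \<Rightarrow> ('u list \<Rightarrow> 'k) \<Rightarrow> bool" where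
  "multiple_summing p Xs \<Phi> \<longleftrightarrow> continuous_multilinear_form Xs \<Phi> \<and> (\<exists>K>0. summing_bound p Xs \<Phi> K)"

definition summing_norm ::
    "real \<Rightarrow> ('k::real_normed_field, 'u) nspace list \<Rightarrow> ('u list \<Rightarrow> 'k) \<Rightarrow> real" where
  "summing_norm p Xs \<Phi> = Inf {K. K > 0 \<and> summing_bound p Xs \<Phi> K}"


section \<open>Algebraic tensor products\<close>

text \<open>
  HOL cannot quantify over types inside a formula, so all spaces live in one universe type that is
  closed under tensor products.  It contains the scalars \<open>'k\<close>, an arbitrary type \<open>'a\<close> of atoms
  (any normed space with elements in \<open>'a\<close> occurs, up to renaming, in the universe) and the formal
  sums \<open>x\<^sub>1 \<otimes> y\<^sub>1 + \<dots> + x\<^sub>n \<otimes> y\<^sub>n\<close> of its own elements, encoded as lists of pairs.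
\<close>

datatype ('k, 'a) tuniv =
    Scalar 'k
  | Atom 'a
  | Formal (formal_sum: "(('k, 'a) tuniv \<times> ('k, 'a) tuniv) list")

type_synonym ('k, 'a) space = "('k, ('k, 'a) tuniv) nspace"

definition bilinear_form ::
    "('k::real_normed_field, 'u) nspace \<Rightarrow> ('k, 'v) nspace \<Rightarrow> ('u \<Rightarrow> 'v \<Rightarrow> 'k) \<Rightarrow> bool" where
  "bilinear_form E F A \<longleftrightarrow> (\<forall>y\<in>carrier F. linear_functional E (\<lambda>x. A x y))
     \<and> (\<forall>x\<in>carrier E. linear_functional F (A x))"

text \<open>
  The usual construction of \<open>E \<otimes> F\<close> inside the algebraic dual of the space of bilinear forms,
  where \<open>x \<otimes> y\<close> is the functional \<open>A \<mapsto> A x y\<close>: two formal sums are the same tensor if and only if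
  they define the same functional.  A tensor is then stored as a chosen representative of its
  class, \<open>tensor_of E F l\<close> being the tensor denoted by the formal sum \<open>l\<close>.
\<close>

definition same_tensor ::
    "('k::real_normed_field, 'u) nspace \<Rightarrow> ('k, 'v) nspace \<Rightarrow> ('u \<times> 'v) list \<Rightarrow> ('u \<times> 'v) list \<Rightarrow> bool" where
  "same_tensor E F l l' \<longleftrightarrow>
     (\<forall>A. bilinear_form E F A \<longrightarrow> (\<Sum>(x, y)\<leftarrow>l. A x y) = (\<Sum>(x, y)\<leftarrow>l'. A x y))"

definition tensor_of ::
    "('k::real_normed_field, 'a) space \<Rightarrow> ('k, 'a) space
      \<Rightarrow> (('k, 'a) tuniv \<times> ('k, 'a) tuniv) list \<Rightarrow> ('k, 'a) tuniv" where
  "tensor_of E F l = Formal (SOME l'. l' \<in> lists (carrier E \<times> carrier F) \<and> same_tensor E F l' l)"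

definition elem_tensor ::
    "('k::real_normed_field, 'a) space \<Rightarrow> ('k, 'a) space
      \<Rightarrow> ('k, 'a) tuniv \<Rightarrow> ('k, 'a) tuniv \<Rightarrow> ('k, 'a) tuniv" where
  "elem_tensor E F x y = tensor_of E F [(x, y)]"

definition normed_tensor ::
    "('k::real_normed_field, 'a) space \<Rightarrow> ('k, 'a) space \<Rightarrow> (('k, 'a) tuniv \<Rightarrow> real) \<Rightarrow> ('k, 'a) space" where
  "normed_tensor E F \<nu> =
     \<lparr>carrier = tensor_of E F ` lists (carrier E \<times> carrier F),
      monoid.mult = undefined, one = undefined,
      ring.zero = tensor_of E F [],
      add = (\<lambda>z w. tensor_of E F (formal_sum z @ formal_sum w)),
      smult = (\<lambda>c z. tensor_of E F (map (\<lambda>(x, y). (c \<odot>\<^bsub>E\<^esub> x, y)) (formal_sum z))),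
      nrm = \<nu>\<rparr>"

definition tensor_map ::
    "('k::real_normed_field, 'a) space \<Rightarrow> ('k, 'a) space
      \<Rightarrow> (('k, 'a) tuniv \<Rightarrow> ('k, 'a) tuniv) \<Rightarrow> (('k, 'a) tuniv \<Rightarrow> ('k, 'a) tuniv)
      \<Rightarrow> ('k, 'a) tuniv \<Rightarrow> ('k, 'a) tuniv" where
  "tensor_map E\<^sub>2 F\<^sub>2 T\<^sub>1 T\<^sub>2 z = tensor_of E\<^sub>2 F\<^sub>2 (map (\<lambda>(x, y). (T\<^sub>1 x, T\<^sub>2 y)) (formal_sum z))"


section \<open>Tensor norms\<close>

type_synonym ('k, 'a) norm_assignment =
  "('k, 'a) space \<Rightarrow> ('k, 'a) space \<Rightarrow> ('k, 'a) tuniv \<Rightarrow> real"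

definition injective_norm :: "('k::real_normed_field, 'a) norm_assignment" where
  "injective_norm E F z =
     (SUP (\<phi>, \<psi>)\<in>dual_ball E \<times> dual_ball F. norm (\<Sum>(x, y)\<leftarrow>formal_sum z. \<phi> x * \<psi> y))"

definition projective_norm :: "('k::real_normed_field, 'a) norm_assignment" where
  "projective_norm E F z =
     (INF l\<in>{l \<in> lists (carrier E \<times> carrier F). tensor_of E F l = z}. \<Sum>(x, y)\<leftarrow>l. nrm E x * nrm F y)"

abbreviation tensor_space ::
    "('k::real_normed_field, 'a) norm_assignment \<Rightarrow> ('k, 'a) space \<Rightarrow> ('k, 'a) space \<Rightarrow> ('k, 'a) space" where
  "tensor_space \<beta> E F \<equiv> normed_tensor E F (\<beta> E F)"

text \<open>The last conjunct is the metric mapping property: \<open>T\<^sub>1 \<otimes> T\<^sub>2\<close> is bounded with norm at most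
  \<open>\<parallel>T\<^sub>1\<parallel> \<parallel>T\<^sub>2\<parallel>\<close>.\<close>

definition tensor_norm :: "('k::real_normed_field, 'a) norm_assignment \<Rightarrow> bool" where
  "tensor_norm \<beta> \<longleftrightarrow>
     (\<forall>E F. normed_space E \<and> normed_space F \<longrightarrow>
        normed_space (tensor_space \<beta> E F)
        \<and> (\<forall>z\<in>carrier (tensor_space \<beta> E F).
              injective_norm E F z \<le> \<beta> E F z \<and> \<beta> E F z \<le> projective_norm E F z))
     \<and> (\<forall>E\<^sub>1 F\<^sub>1 E\<^sub>2 F\<^sub>2 T\<^sub>1 T\<^sub>2.
          normed_space E\<^sub>1 \<and> normed_space F\<^sub>1 \<and> normed_space E\<^sub>2 \<and> normed_space F\<^sub>2
          \<and> bounded_op E\<^sub>1 E\<^sub>2 T\<^sub>1 \<and> bounded_op F\<^sub>1 F\<^sub>2 T\<^sub>2 \<longrightarrow>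
          (\<forall>z\<in>carrier (tensor_space \<beta> E\<^sub>1 F\<^sub>1).
              \<beta> E\<^sub>2 F\<^sub>2 (tensor_map E\<^sub>2 F\<^sub>2 T\<^sub>1 T\<^sub>2 z) \<le> op_norm E\<^sub>1 E\<^sub>2 T\<^sub>1 * op_norm F\<^sub>1 F\<^sub>2 T\<^sub>2 * \<beta> E\<^sub>1 F\<^sub>1 z))"

text \<open>
  The canonical identification of \<open>(E \<otimes> F) \<otimes> G\<close> with \<open>E \<otimes> (F \<otimes> G)\<close> sends
  \<open>\<Sum> (x \<otimes> y) \<otimes> z\<close> to \<open>\<Sum> x \<otimes> (y \<otimes> z)\<close>, and every tensor is such a sum; associativity
  says that it is an isometry.
\<close>

definition associative :: "('k::real_normed_field, 'a) norm_assignment \<Rightarrow> bool" where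
  "associative \<beta> \<longleftrightarrow>
     (\<forall>E F G. normed_space E \<and> normed_space F \<and> normed_space G \<longrightarrow>
        (\<forall>l\<in>lists (carrier E \<times> carrier F \<times> carrier G).
           \<beta> (tensor_space \<beta> E F) G
             (tensor_of (tensor_space \<beta> E F) G (map (\<lambda>(x, y, z). (elem_tensor E F x y, z)) l))
         = \<beta> E (tensor_space \<beta> F G)
             (tensor_of E (tensor_space \<beta> F G) (map (\<lambda>(x, y, z). (x, elem_tensor F G y z)) l))))"

text \<open>The \<open>N\<close>-fold tensor product \<open>(\<dots>((X\<^sub>1 \<otimes> X\<^sub>2) \<otimes> X\<^sub>3)\<dots>) \<otimes> X\<^sub>N\<close> with the iterated norm,
  and the tensors \<open>x\<^sub>1 \<otimes> \<dots> \<otimes> x\<^sub>N\<close> in it.\<close>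

fun ntensor_space ::
    "('k::real_normed_field, 'a) norm_assignment \<Rightarrow> ('k, 'a) space list \<Rightarrow> ('k, 'a) space" where
  "ntensor_space \<beta> [E] = E"
| "ntensor_space \<beta> (E # F # Fs) = ntensor_space \<beta> (tensor_space \<beta> E F # Fs)"

fun nelem_tensor ::
    "('k::real_normed_field, 'a) norm_assignment \<Rightarrow> ('k, 'a) space list
      \<Rightarrow> ('k, 'a) tuniv list \<Rightarrow> ('k, 'a) tuniv" where
  "nelem_tensor \<beta> [E] [x] = x"
| "nelem_tensor \<beta> (E # F # Fs) (x # y # ys) =
     nelem_tensor \<beta> (tensor_space \<beta> E F # Fs) (elem_tensor E F x y # ys)"


section \<open>Duality\<close>

definition linearization ::
    "('k::real_normed_field, 'a) norm_assignment \<Rightarrow> ('k, 'a) space list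
      \<Rightarrow> (('k, 'a) tuniv list \<Rightarrow> 'k) \<Rightarrow> (('k, 'a) tuniv \<Rightarrow> 'k) \<Rightarrow> bool" where
  "linearization \<beta> Xs \<Phi> L \<longleftrightarrow> linear_functional (ntensor_space \<beta> Xs) L
     \<and> (\<forall>xs\<in>listset (map carrier Xs). L (nelem_tensor \<beta> Xs xs) = \<Phi> xs)"

text \<open>The space of multiple \<open>p\<close>-summing forms on \<open>Xs\<close> and the dual of the tensor product coincide
  under linearization, with equivalent norms.\<close>

definition summing_isomorphic_dual ::
    "real \<Rightarrow> ('k::real_normed_field, 'a) norm_assignment \<Rightarrow> ('k, 'a) space list \<Rightarrow> bool" where
  "summing_isomorphic_dual p \<beta> Xs \<longleftrightarrow>
     (\<forall>\<Phi>. multilinear_form Xs \<Phi> \<longrightarrow>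
        (multiple_summing p Xs \<Phi> \<longleftrightarrow>
          (\<exists>L. linearization \<beta> Xs \<Phi> L \<and> bounded_functional (ntensor_space \<beta> Xs) L)))
     \<and> (\<exists>c>0. \<exists>C>0. \<forall>\<Phi> L.
          multiple_summing p Xs \<Phi> \<and> linearization \<beta> Xs \<Phi> L \<longrightarrow>
          c * summing_norm p Xs \<Phi> \<le> dual_norm (ntensor_space \<beta> Xs) L
          \<and> dual_norm (ntensor_space \<beta> Xs) L \<le> C * summing_norm p Xs \<Phi>)"

definition summing_ideal_dual_to ::
    "real \<Rightarrow> ('k::real_normed_field, 'a) norm_assignment \<Rightarrow> bool" where
  "summing_ideal_dual_to p \<beta> \<longleftrightarrow>
     (\<forall>Xs. length Xs \<ge> 2 \<and> (\<forall>X\<in>set Xs. banach_space X) \<longrightarrow> summing_isomorphic_dual p \<beta> Xs)"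

end

(* The duality already fails for N = 3, with X = l_infinity and H = l_2.  Let d = 2^p and let
   u_(r,s) be monomial unitaries of dimension d (signed permutations) such that the matrix entries
   of sqrt(d) u_(r,s) are orthonormal on the index set.  Averaging against them defines a contraction
   m from l_infinity into the Hilbert-Schmidt operators which is 2-summing with constant 1, so the
   trilinear form <m(c) y, z> on X x H x H is multiple 2-summing with constant 1 for every d.

   On the other hand R x = d^(-1/2) sum_k (u x)_k (x) e_k is, with (x) the tensor sign, the image of the tensor
   t = d^(-1/2) sum_k e_k (x) e_k under (operator of norm at most |x|) (x) id.  Multiple 2-summing
   forms on H x H are the Hilbert-Schmidt ones, hence beta(t) is bounded independently of d, and R
   maps H into the beta-tensor product of X and H with bounded norm.  If beta were predual to the
   multiple 2-summing forms, composing the trilinear form with R would give forms on H x H of bounded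
   Hilbert-Schmidt norm; but the composition is sum_(i<d) x_i z_i, whose norm is sqrt(d). *)

theory Submission
  imports Defs "HOL-Analysis.L2_Norm" "HOL-Analysis.Inner_Product" "HOL-Library.Countable"
begin

section \<open>Encoding sequences by scalars\<close>

text \<open>The constants of a norm equivalence may depend on the spaces, so X and H are fixed,
  infinite-dimensional, and hold the configurations of every dimension d at once; then one constant
  \<open>\<delta>\<close> on H x H and one constant \<open>C\<close> on X x H x H serve for all d.
  The obstacle is the bound on beta(t): duality controls functionals, while an upper bound for a
  tensor asks for a norming functional. The operators u_(r,s) supply it. Averaging u (x) u over them
  is a projection of norm at most 1 onto the line of t, so the trace form, rescaled to take the
  value beta(t) at t, has norm at most 1 on the tensor product, and its Hilbert-Schmidt norm is
  explicit. Signs rather than complex phases make u (x) u fix t without any conjugation, so one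
  argument covers both scalar fields. The code leaves out d^(-1/2) and works with sqrt(d) t and
  sqrt(d) R.\<close>

lemma ex_inj_nat_set_real: "\<exists>f :: nat set \<Rightarrow> real. inj f"
proof -
  \<comment> \<open>Base 3 leaves room that base 2 would not: at the first disagreement
    \<open>m\<close> the terms differ by 3^(-m), while all later terms together differ by at most
    half of that.\<close>
  define t :: "nat set \<Rightarrow> nat \<Rightarrow> real" where "t S n = (if n \<in> S then (1/3) ^ n else 0)" for S n
  have geo: "summable (\<lambda>n. (1/3::real) ^ n)"
    by (rule summable_geometric) simp
  have t_le: "\<bar>t S n - t T n\<bar> \<le> (1/3) ^ n" for S T n
    by (auto simp: t_def)
  have summ: "summable (t S)" for S
    by (rule summable_comparison_test'[OF geo, of 0]) (auto simp: t_def)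
  have "inj (\<lambda>S. suminf (t S))"
  proof (rule injI, rule ccontr)
    fix S T :: "nat set"
    assume eq: "suminf (t S) = suminf (t T)" and ne: "S \<noteq> T"
    define D where "D n = t S n - t T n" for n
    define m where "m = (LEAST n. (n \<in> S) \<noteq> (n \<in> T))"
    have ex: "\<exists>n. (n \<in> S) \<noteq> (n \<in> T)"
      using ne by blast
    have m: "(m \<in> S) \<noteq> (m \<in> T)"
      unfolding m_def by (rule LeastI_ex[OF ex])
    have lt: "D n = 0" if "n < m" for n
      using not_less_Least[of n "\<lambda>n. (n \<in> S) \<noteq> (n \<in> T)"] that by (auto simp: D_def t_def m_def)
    have sD: "summable D"
      unfolding D_def by (intro summable_diff summ)
    have "0 = suminf D"
      unfolding D_def by (simp add: suminf_diff[OF summ summ, symmetric] eq)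
    also have "\<dots> = (\<Sum>n. D (n + Suc m)) + (\<Sum>n<Suc m. D n)"
      by (rule suminf_split_initial_segment[OF sD])
    also have "(\<Sum>n<Suc m. D n) = D m"
      using lt by simp
    finally have "\<bar>D m\<bar> = \<bar>\<Sum>n. D (n + Suc m)\<bar>"
      by simp
    also have "\<dots> \<le> (\<Sum>n. (1/3) ^ Suc m * (1/3) ^ n)"
    proof -
      have "summable (\<lambda>n. (1/3::real) ^ Suc m * (1/3) ^ n)"
        by (intro summable_mult geo)
      moreover have "norm (D (n + Suc m)) \<le> (1/3) ^ Suc m * (1/3) ^ n" for n
        using t_le[of S "n + Suc m" T] by (simp add: D_def power_add mult_ac)
      ultimately show ?thesis
        using norm_suminf_le[of "\<lambda>n. D (n + Suc m)"] by fastforce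
    qed
    also have "\<dots> = (1/3) ^ Suc m * (\<Sum>n. (1/3) ^ n)"
      by (rule suminf_mult[OF geo])
    also have "(\<Sum>n. (1/3::real) ^ n) = 3/2"
      by (subst suminf_geometric) auto
    finally have "\<bar>D m\<bar> \<le> (1/3) ^ m / 2"
      by simp
    moreover have "\<bar>D m\<bar> = (1/3) ^ m"
      using m by (auto simp: D_def t_def)
    ultimately show False
      by simp
  qed
  then show ?thesis by blast
qed

text \<open>The Dedekind cuts of all terms form a set of pairs (index, rational). Such pairs are
  countable, so a sequence is coded by a set of natural numbers.\<close>

lemma ex_inj_real_seq: "\<exists>f :: (nat \<Rightarrow> real) \<Rightarrow> real. inj f"
proof -
  obtain f :: "nat set \<Rightarrow> real" where f: "inj f"
    using ex_inj_nat_set_real by blast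
  define g :: "(nat \<Rightarrow> real) \<Rightarrow> nat set"
    where "g x = to_nat ` {(n::nat, q::rat). of_rat q < x n}" for x
  have "inj g"
  proof (rule injI)
    fix x y assume "g x = g y"
    then have "{(n::nat, q::rat). of_rat q < x n} = {(n, q). of_rat q < y n}"
      unfolding g_def by (rule inj_image_eq_iff[OF inj_to_nat, THEN iffD1])
    then have *: "of_rat q < x n \<longleftrightarrow> of_rat q < y n" for n and q :: rat
      by (auto simp: set_eq_iff)
    show "x = y"
    proof
      fix n show "x n = y n"
        using * of_rat_dense[of "x n" "y n"] of_rat_dense[of "y n" "x n"]
        by (metis less_asym linorder_neqE)
    qed
  qed
  then have "inj (f \<circ> g)"
    using f by (simp add: inj_compose)
  then show ?thesis by blast
qed

lemma ex_inj_complex_seq: "\<exists>f :: (nat \<Rightarrow> complex) \<Rightarrow> real. inj f"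
proof -
  obtain f :: "(nat \<Rightarrow> real) \<Rightarrow> real" where f: "inj f"
    using ex_inj_real_seq by blast
  define g :: "(nat \<Rightarrow> complex) \<Rightarrow> nat \<Rightarrow> real"
    where "g x n = (if even n then Re (x (n div 2)) else Im (x (n div 2)))" for x n
  have "inj g"
  proof (rule injI)
    fix x y assume "g x = g y"
    then have "g x (2 * n) = g y (2 * n)" "g x (2 * n + 1) = g y (2 * n + 1)" for n
      by simp_all
    then show "x = y"
      by (auto simp: g_def complex_eq_iff)
  qed
  then have "inj (f \<circ> g)"
    using f by (simp add: inj_compose)
  then show ?thesis by blast
qed

section \<open>Sequence spaces\<close>

text \<open>Sequences are transported along an injection \<open>enc\<close> so that they can live in the universe of
  the tensor norm.\<close>

definition seq_space ::
    "(nat \<Rightarrow> (nat \<Rightarrow> 'k) \<Rightarrow> real) \<Rightarrow> ((nat \<Rightarrow> 'k) \<Rightarrow> 'u) \<Rightarrow> ('k::real_normed_field, 'u) nspace" where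
  "seq_space N enc =
     \<lparr>carrier = enc ` {f. bdd_above (range (\<lambda>n. N n f))},
      monoid.mult = undefined, one = undefined,
      ring.zero = enc (\<lambda>_. 0),
      add = (\<lambda>x y. enc (\<lambda>i. the_inv enc x i + the_inv enc y i)),
      smult = (\<lambda>c x. enc (\<lambda>i. c * the_inv enc x i)),
      nrm = (\<lambda>x. SUP n. N n (the_inv enc x))\<rparr>"

lemma cring_scalar_ring: "cring (scalar_ring :: 'k::real_normed_field ring)"
  by (rule cringI, rule abelian_groupI, unfold_locales)
    (auto simp: scalar_ring_def algebra_simps intro: exI[of _ "- x" for x])

text \<open>A norm that is a supremum of seminorms covers both spaces: truncated Euclidean norms
  give l_2, single coordinates give l_infinity. \<open>N_coord\<close> makes the norm control each
  coordinate, and \<open>N_tendsto\<close> lets each seminorm pass to coordinatewise limits;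
  completeness rests on these two.\<close>

locale seq_norm =
  fixes N :: "nat \<Rightarrow> (nat \<Rightarrow> 'k::{real_normed_field,banach}) \<Rightarrow> real"
    and enc :: "(nat \<Rightarrow> 'k) \<Rightarrow> 'u"
  assumes inj_enc: "inj enc"
    and N_scale: "N n (\<lambda>i. c * f i) = norm c * N n f"
    and N_add: "N n (\<lambda>i. f i + g i) \<le> N n f + N n g"
    and N_coord: "\<exists>n. \<forall>f. norm (f i) \<le> N n f"
    and N_tendsto: "(\<And>i. (\<lambda>m. h m i) \<longlonglongrightarrow> f i) \<Longrightarrow> (\<lambda>m. N n (h m)) \<longlonglongrightarrow> N n f"
begin

abbreviation "S \<equiv> seq_space N enc"

lemma dec_enc [simp]: "the_inv enc (enc f) = f"
  by (simp add: inj_enc the_inv_f_f)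

lemma N_zero: "N n (\<lambda>_. 0) = 0"
  using N_scale[of n 0 "\<lambda>_. 0"] by simp

lemma N_nonneg: "0 \<le> N n f"
  using N_add[of n f "\<lambda>i. -1 * f i"] N_scale[of n "-1" f] N_zero[of n] by simp

lemma carrier_iff: "enc f \<in> carrier S \<longleftrightarrow> bdd_above (range (\<lambda>n. N n f))"
  using inj_enc by (auto simp: seq_space_def inj_image_mem_iff)

lemma in_carrierI: "(\<And>n. N n f \<le> C) \<Longrightarrow> enc f \<in> carrier S"
  unfolding carrier_iff by (auto simp: bdd_above_def)

lemma enc_cases:
  assumes "x \<in> carrier S"
  obtains f where "x = enc f" "bdd_above (range (\<lambda>n. N n f))"
  using assms by (auto simp: seq_space_def)

lemma nrm_enc: "nrm S (enc f) = (SUP n. N n f)"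
  by (simp add: seq_space_def)

lemma nrm_leI: "(\<And>n. N n f \<le> C) \<Longrightarrow> nrm S (enc f) \<le> C"
  unfolding nrm_enc by (rule cSUP_least) auto

lemma le_nrm: "enc f \<in> carrier S \<Longrightarrow> N n f \<le> nrm S (enc f)"
  unfolding nrm_enc carrier_iff by (rule cSUP_upper) auto

lemma add_enc: "enc f \<oplus>\<^bsub>S\<^esub> enc g = enc (\<lambda>i. f i + g i)"
  by (simp add: seq_space_def)

lemma smult_enc: "c \<odot>\<^bsub>S\<^esub> enc f = enc (\<lambda>i. c * f i)"
  by (simp add: seq_space_def)

lemma zero_enc: "\<zero>\<^bsub>S\<^esub> = enc (\<lambda>i. 0)"
  by (simp add: seq_space_def)

lemma add_in_carrier: "enc f \<in> carrier S \<Longrightarrow> enc g \<in> carrier S \<Longrightarrow> enc (\<lambda>i. f i + g i) \<in> carrier S"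
  by (rule in_carrierI[of _ "nrm S (enc f) + nrm S (enc g)"])
    (rule order_trans[OF N_add], intro add_mono le_nrm)

lemma scale_in_carrier: "enc f \<in> carrier S \<Longrightarrow> enc (\<lambda>i. c * f i) \<in> carrier S"
  by (rule in_carrierI[of _ "norm c * nrm S (enc f)"]) (simp add: N_scale le_nrm mult_left_mono)

lemma zero_in_carrier: "enc (\<lambda>i. 0) \<in> carrier S"
  by (rule in_carrierI[of _ 0]) (simp add: N_zero)

lemma nrm_nonneg: "enc f \<in> carrier S \<Longrightarrow> 0 \<le> nrm S (enc f)"
  using N_nonneg[of 0 f] le_nrm[of f 0] by linarith

lemma coord_le_nrm: "enc f \<in> carrier S \<Longrightarrow> norm (f i) \<le> nrm S (enc f)"
  using N_coord[of i] le_nrm[of f] by (meson order_trans)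

lemma abelian_group_S: "abelian_group S"
proof (rule abelian_groupI)
  fix x assume "x \<in> carrier S"
  then obtain f where x: "x = enc f" and f: "enc f \<in> carrier S"
    by (metis enc_cases carrier_iff)
  show "\<exists>y\<in>carrier S. y \<oplus>\<^bsub>S\<^esub> x = \<zero>\<^bsub>S\<^esub>"
    by (rule bexI[OF _ scale_in_carrier[OF f, of "-1"]]) (simp add: x add_enc zero_enc)
qed (auto elim!: enc_cases simp: add_enc zero_enc carrier_iff[symmetric] add_in_carrier
  zero_in_carrier algebra_simps)

lemma minus_enc:
  assumes "enc f \<in> carrier S" "enc g \<in> carrier S"
  shows "enc f \<ominus>\<^bsub>S\<^esub> enc g = enc (\<lambda>i. f i - g i)"
proof -
  interpret abelian_group S by (rule abelian_group_S)
  have "\<ominus>\<^bsub>S\<^esub> enc g = enc (\<lambda>i. -1 * g i)"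
    by (rule minus_equality) (use scale_in_carrier[OF assms(2), of "-1"] assms
        in \<open>auto simp: add_enc zero_enc\<close>)
  then show ?thesis
    by (simp add: a_minus_def add_enc)
qed

lemma normed_space_S: "normed_space S"
  unfolding normed_space_def
proof (intro conjI ballI allI)
  show "module scalar_ring S"
  proof (rule moduleI[OF cring_scalar_ring abelian_group_S])
  qed (auto elim!: enc_cases simp: add_enc smult_enc carrier_iff[symmetric] scale_in_carrier
    scalar_ring_def algebra_simps)
next
  fix x assume "x \<in> carrier S"
  then obtain f where x: "x = enc f" and f: "enc f \<in> carrier S"
    by (metis enc_cases carrier_iff)
  show "0 \<le> nrm S x"
    using nrm_nonneg f x by simp
  show "nrm S x = 0 \<longleftrightarrow> x = \<zero>\<^bsub>S\<^esub>"
  proof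
    assume "nrm S x = 0"
    then have "f i = 0" for i
      using coord_le_nrm[OF f, of i] x by simp
    then show "x = \<zero>\<^bsub>S\<^esub>"
      by (auto simp: x zero_enc intro!: arg_cong[of _ _ enc])
  qed (simp add: zero_enc nrm_enc N_zero)
  fix c
  show "nrm S (c \<odot>\<^bsub>S\<^esub> x) = norm c * nrm S x"
  proof (rule antisym)
    have le: "nrm S (c \<odot>\<^bsub>S\<^esub> enc f) \<le> norm c * nrm S (enc f)" if "enc f \<in> carrier S" for c f
      unfolding smult_enc using that
      by (intro nrm_leI) (simp add: N_scale le_nrm mult_left_mono)
    then show "nrm S (c \<odot>\<^bsub>S\<^esub> x) \<le> norm c * nrm S x"
      using f x by simp
    show "norm c * nrm S x \<le> nrm S (c \<odot>\<^bsub>S\<^esub> x)"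
    proof (cases "c = 0")
      case True
      then show ?thesis using nrm_nonneg[OF zero_in_carrier] by (simp add: x smult_enc)
    next
      case False
      have "nrm S x \<le> norm (inverse c) * nrm S (c \<odot>\<^bsub>S\<^esub> x)"
        using le[OF scale_in_carrier[OF f, of c], of "inverse c"] False
        by (simp add: x smult_enc mult.assoc[symmetric])
      then show ?thesis
        using False by (simp add: norm_divide field_simps)
    qed
  qed
next
  fix x y assume "x \<in> carrier S" "y \<in> carrier S"
  then obtain f g where x: "x = enc f" and f: "enc f \<in> carrier S"
    and y: "y = enc g" and g: "enc g \<in> carrier S"
    by (metis enc_cases carrier_iff)
  show "nrm S (x \<oplus>\<^bsub>S\<^esub> y) \<le> nrm S x + nrm S y"
    unfolding x y add_enc using f g
    by (intro nrm_leI order_trans[OF N_add] add_mono le_nrm)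
qed

text \<open>Coordinatewise limits exist by \<open>N_coord\<close>. The Cauchy estimate bounds all
  seminorms at once, so taking the limit in one seminorm at a time keeps a bound uniform in the
  index of the seminorm.\<close>

lemma banach_space_S: "banach_space S"
  unfolding banach_space_def
proof (intro conjI allI impI normed_space_S)
  fix s :: "nat \<Rightarrow> 'u"
  assume A: "(\<forall>n. s n \<in> carrier S) \<and>
    (\<forall>e>0. \<exists>M. \<forall>m\<ge>M. \<forall>n\<ge>M. nrm S (s m \<ominus>\<^bsub>S\<^esub> s n) < e)"
  define g where "g n = the_inv enc (s n)" for n
  have s: "s n = enc (g n)" for n
    using A by (metis enc_cases dec_enc g_def)
  have gc: "enc (g n) \<in> carrier S" for n
    using A s by metis
  have diff: "enc (\<lambda>i. g m i - g n i) \<in> carrier S" for m n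
    using add_in_carrier[OF gc scale_in_carrier[OF gc, of "-1"], of m n] by simp
  have cauchy: "\<exists>M. \<forall>m\<ge>M. \<forall>n\<ge>M. nrm S (enc (\<lambda>i. g m i - g n i)) < e" if "e > 0" for e
    using A that by (simp add: s minus_enc gc)
  have "Cauchy (\<lambda>n. g n i)" for i
    unfolding Cauchy_def dist_norm
    using cauchy coord_le_nrm[OF diff] by (meson le_less_trans)
  then have "\<exists>l. (\<lambda>n. g n i) \<longlonglongrightarrow> l" for i
    by (simp add: Cauchy_convergent_iff convergent_def)
  then obtain f where f: "(\<lambda>n. g n i) \<longlonglongrightarrow> f i" for i
    by metis
  have lim: "\<exists>M. \<forall>m\<ge>M. \<forall>n. N n (\<lambda>i. g m i - f i) \<le> e" if e: "e > 0" for e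
  proof -
    obtain M where M: "\<And>m n. m \<ge> M \<Longrightarrow> n \<ge> M \<Longrightarrow> nrm S (enc (\<lambda>i. g m i - g n i)) < e"
      using cauchy[OF e] by blast
    have "N n (\<lambda>i. g m i - f i) \<le> e" if m: "m \<ge> M" for m n
    proof (rule LIMSEQ_le_const2)
      show "(\<lambda>k. N n (\<lambda>i. g m i - g k i)) \<longlonglongrightarrow> N n (\<lambda>i. g m i - f i)"
        by (rule N_tendsto) (intro tendsto_intros f)
      show "\<exists>K. \<forall>k\<ge>K. N n (\<lambda>i. g m i - g k i) \<le> e"
        using M[OF m] le_nrm[OF diff] by (meson less_imp_le order_trans)
    qed
    then show ?thesis by blast
  qed
  \<comment> \<open>So far the limit \<open>f\<close> is a mere sequence; distance at most 1 from
    some \<open>g m\<close> puts it into the carrier.\<close>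
  obtain m where m: "\<And>n. N n (\<lambda>i. g m i - f i) \<le> 1"
    using lim[of 1] by auto
  have fc: "enc f \<in> carrier S"
    using add_in_carrier[OF gc scale_in_carrier[OF in_carrierI[OF m], of "-1"], of m] by simp
  have gf: "enc (\<lambda>i. g m i - f i) \<in> carrier S" for m
    using add_in_carrier[OF gc scale_in_carrier[OF fc, of "-1"], of m] by simp
  have "(\<lambda>n. nrm S (s n \<ominus>\<^bsub>S\<^esub> enc f)) \<longlonglongrightarrow> 0"
  proof (rule LIMSEQ_I)
    fix r :: real assume "0 < r"
    then obtain M where M: "\<And>m n. m \<ge> M \<Longrightarrow> N n (\<lambda>i. g m i - f i) \<le> r / 2"
      using lim[of "r / 2"] by auto
    have "nrm S (enc (\<lambda>i. g m i - f i)) \<le> r / 2" if "m \<ge> M" for m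
      using M[OF that] by (rule nrm_leI)
    then have "norm (nrm S (s m \<ominus>\<^bsub>S\<^esub> enc f) - 0) < r" if "m \<ge> M" for m
      using nrm_nonneg[OF gf, of m] that \<open>0 < r\<close> by (fastforce simp: s minus_enc gc fc)
    then show "\<exists>no. \<forall>n\<ge>no. norm (nrm S (s n \<ominus>\<^bsub>S\<^esub> enc f) - 0) < r"
      by blast
  qed
  then show "\<exists>x\<in>carrier S. (\<lambda>n. nrm S (s n \<ominus>\<^bsub>S\<^esub> x)) \<longlonglongrightarrow> 0"
    using fc by blast
qed

end

abbreviation ell2 :: "((nat \<Rightarrow> 'k) \<Rightarrow> 'u) \<Rightarrow> ('k::real_normed_field, 'u) nspace" where
  "ell2 \<equiv> seq_space (\<lambda>n f. L2_set (\<lambda>i. norm (f i)) {..<n})"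

abbreviation linf :: "((nat \<Rightarrow> 'k) \<Rightarrow> 'u) \<Rightarrow> ('k::real_normed_field, 'u) nspace" where
  "linf \<equiv> seq_space (\<lambda>n f. norm (f n))"

lemma seq_norm_ell2:
  fixes enc :: "(nat \<Rightarrow> 'k::{real_normed_field,banach}) \<Rightarrow> 'u"
  assumes "inj enc"
  shows "seq_norm (\<lambda>n f. L2_set (\<lambda>i. norm (f i)) {..<n}) enc"
proof
  fix n and f g :: "nat \<Rightarrow> 'k"
  show "L2_set (\<lambda>i. norm (f i + g i)) {..<n}
      \<le> L2_set (\<lambda>i. norm (f i)) {..<n} + L2_set (\<lambda>i. norm (g i)) {..<n}"
    by (rule order_trans[OF L2_set_mono L2_set_triangle_ineq]) (auto intro: norm_triangle_ineq)
next
  fix i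
  have "norm (f i) \<le> L2_set (\<lambda>i. norm (f i)) {..<Suc i}" for f :: "nat \<Rightarrow> 'k"
    using member_le_L2_set[of "{..<Suc i}" i "\<lambda>i. norm (f i)"] by simp
  then show "\<exists>n. \<forall>f :: nat \<Rightarrow> 'k. norm (f i) \<le> L2_set (\<lambda>i. norm (f i)) {..<n}"
    by blast
qed (auto simp: assms norm_mult L2_set_def power_mult_distrib sum_distrib_left[symmetric]
  real_sqrt_mult intro!: tendsto_intros)

lemma seq_norm_linf:
  fixes enc :: "(nat \<Rightarrow> 'k::{real_normed_field,banach}) \<Rightarrow> 'u"
  assumes "inj enc"
  shows "seq_norm (\<lambda>n f. norm (f n)) enc"
  by standard (auto simp: assms norm_mult norm_triangle_ineq intro!: tendsto_intros)

section \<open>Functionals and operators\<close>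

lemma normed_spaceD:
  assumes "normed_space E"
  shows "module scalar_ring E"
    "\<And>x. x \<in> carrier E \<Longrightarrow> 0 \<le> nrm E x"
    "\<And>x. x \<in> carrier E \<Longrightarrow> nrm E x = 0 \<longleftrightarrow> x = \<zero>\<^bsub>E\<^esub>"
    "\<And>c x. x \<in> carrier E \<Longrightarrow> nrm E (c \<odot>\<^bsub>E\<^esub> x) = norm c * nrm E x"
    "\<And>x y. x \<in> carrier E \<Longrightarrow> y \<in> carrier E \<Longrightarrow> nrm E (x \<oplus>\<^bsub>E\<^esub> y) \<le> nrm E x + nrm E y"
  using assms by (auto simp: normed_space_def)

lemma normed_space_closed:
  assumes "normed_space E"
  shows "\<And>x y. x \<in> carrier E \<Longrightarrow> y \<in> carrier E \<Longrightarrow> x \<oplus>\<^bsub>E\<^esub> y \<in> carrier E"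
    "\<And>c x. x \<in> carrier E \<Longrightarrow> c \<odot>\<^bsub>E\<^esub> x \<in> carrier E"
    "\<zero>\<^bsub>E\<^esub> \<in> carrier E"
proof -
  interpret module scalar_ring E
    by (rule normed_spaceD(1)[OF assms])
  show "x \<oplus>\<^bsub>E\<^esub> y \<in> carrier E" if "x \<in> carrier E" "y \<in> carrier E" for x y
    using that by simp
  show "c \<odot>\<^bsub>E\<^esub> x \<in> carrier E" if "x \<in> carrier E" for c x
    using that by (intro smult_closed) (simp add: scalar_ring_def)
  show "\<zero>\<^bsub>E\<^esub> \<in> carrier E" by simp
qed

lemma nrm_zero: "normed_space E \<Longrightarrow> nrm E \<zero>\<^bsub>E\<^esub> = 0"
  by (simp add: normed_spaceD(3) normed_space_closed(3))

lemma unit_ball_nonempty: "normed_space E \<Longrightarrow> {x \<in> carrier E. nrm E x \<le> 1} \<noteq> {}"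
  using nrm_zero normed_space_closed(3) by fastforce

lemma bdd_above_unit_ball:
  assumes E: "normed_space E" and C: "\<And>x. x \<in> carrier E \<Longrightarrow> g x \<le> C * nrm E x"
  shows "bdd_above ((g :: _ \<Rightarrow> real) ` {x \<in> carrier E. nrm E x \<le> 1})"
proof (rule bdd_aboveI2)
  fix y assume y: "y \<in> {x \<in> carrier E. nrm E x \<le> 1}"
  have "C * nrm E y \<le> \<bar>C\<bar> * 1"
    using y normed_spaceD(2)[OF E] by (intro mult_mono) auto
  then show "g y \<le> \<bar>C\<bar>"
    using C[of y] y by simp
qed

lemma linear_functional_add:
  "linear_functional E \<phi> \<Longrightarrow> x \<in> carrier E \<Longrightarrow> y \<in> carrier E \<Longrightarrow> \<phi> (x \<oplus>\<^bsub>E\<^esub> y) = \<phi> x + \<phi> y"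
  by (simp add: linear_functional_def)

lemma linear_functional_scale:
  "linear_functional E \<phi> \<Longrightarrow> x \<in> carrier E \<Longrightarrow> \<phi> (c \<odot>\<^bsub>E\<^esub> x) = c * \<phi> x"
  by (simp add: linear_functional_def)

lemma dual_norm_leI:
  assumes "normed_space E" "\<And>x. x \<in> carrier E \<Longrightarrow> norm (\<phi> x) \<le> C * nrm E x" "0 \<le> C"
  shows "dual_norm E \<phi> \<le> C"
  unfolding dual_norm_def
proof (rule cSUP_least[OF unit_ball_nonempty[OF assms(1)]])
  fix x assume "x \<in> {x \<in> carrier E. nrm E x \<le> 1}"
  then have x: "x \<in> carrier E" "nrm E x \<le> 1" by auto
  have "C * nrm E x \<le> C * 1"
    using x assms(3) by (intro mult_left_mono)
  then show "norm (\<phi> x) \<le> C"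
    using assms(2)[OF x(1)] by simp
qed

lemma op_norm_leI:
  assumes "normed_space E" "\<And>x. x \<in> carrier E \<Longrightarrow> nrm F (T x) \<le> C * nrm E x" "0 \<le> C"
  shows "op_norm E F T \<le> C"
  unfolding op_norm_def
proof (rule cSUP_least[OF unit_ball_nonempty[OF assms(1)]])
  fix x assume "x \<in> {x \<in> carrier E. nrm E x \<le> 1}"
  then have x: "x \<in> carrier E" "nrm E x \<le> 1" by auto
  have "C * nrm E x \<le> C * 1"
    using x assms(3) by (intro mult_left_mono)
  then show "nrm F (T x) \<le> C"
    using assms(2)[OF x(1)] by simp
qed

lemma op_norm_nonneg:
  assumes "normed_space E" "normed_space F" "bounded_op E F T"
  shows "0 \<le> op_norm E F T"
proof -
  obtain C where "\<forall>x\<in>carrier E. nrm F (T x) \<le> C * nrm E x"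
    using assms(3) unfolding bounded_op_def by blast
  then have "bdd_above ((\<lambda>x. nrm F (T x)) ` {x \<in> carrier E. nrm E x \<le> 1})"
    by (intro bdd_above_unit_ball[OF assms(1)]) blast
  then have "nrm F (T \<zero>\<^bsub>E\<^esub>) \<le> op_norm E F T"
    unfolding op_norm_def using nrm_zero[OF assms(1)] normed_space_closed(3)[OF assms(1)]
    by (intro cSUP_upper) auto
  moreover have "0 \<le> nrm F (T \<zero>\<^bsub>E\<^esub>)"
    using assms(3) normed_space_closed(3)[OF assms(1)]
    by (intro normed_spaceD(2)[OF assms(2)]) (auto simp: bounded_op_def)
  ultimately show ?thesis by linarith
qed

lemma norm_le_dual_norm:
  fixes E :: "('k::real_normed_field, 'u) nspace"
  assumes E: "normed_space E" and \<phi>: "bounded_functional E \<phi>" and x: "x \<in> carrier E"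
  shows "norm (\<phi> x) \<le> dual_norm E \<phi> * nrm E x"
proof -
  obtain C where C: "\<And>x. x \<in> carrier E \<Longrightarrow> norm (\<phi> x) \<le> C * nrm E x"
    and lin: "linear_functional E \<phi>"
    using \<phi> by (auto simp: bounded_functional_def)
  have bdd: "bdd_above ((\<lambda>x. norm (\<phi> x)) ` {x \<in> carrier E. nrm E x \<le> 1})"
    using C by (rule bdd_above_unit_ball[OF E])
  show ?thesis
  proof (cases "nrm E x = 0")
    case True
    then show ?thesis using C[OF x] by simp
  next
    case False
    then have pos: "nrm E x > 0"
      using normed_spaceD(2)[OF E x] by simp
    define c :: 'k where "c = of_real (inverse (nrm E x))"
    have nc: "norm c = inverse (nrm E x)"
      using pos by (simp add: c_def norm_inverse)
    have "nrm E (c \<odot>\<^bsub>E\<^esub> x) \<le> 1"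
      using pos by (simp add: normed_spaceD(4)[OF E x] nc)
    then have "norm (\<phi> (c \<odot>\<^bsub>E\<^esub> x)) \<le> dual_norm E \<phi>"
      unfolding dual_norm_def using normed_space_closed(2)[OF E x]
      by (intro cSUP_upper[OF _ bdd]) auto
    then show ?thesis
      using pos by (simp add: linear_functional_scale[OF lin x] norm_mult nc field_simps)
  qed
qed

lemma bounded_op_id: "bounded_op E E (\<lambda>x. x)"
  by (auto simp: bounded_op_def intro: exI[of _ 1])

lemma op_norm_id_le: "normed_space E \<Longrightarrow> op_norm E E (\<lambda>x. x) \<le> 1"
  by (rule op_norm_leI) simp_all

section \<open>The weak 2-norm\<close>

lemma powr_half_sum: "(\<Sum>i\<in>I. norm (f i) powr 2) powr (1 / 2) = L2_set (\<lambda>i. norm (f i)) I"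
  by (simp add: L2_set_def powr_half_sqrt sum_nonneg)

lemma weak_norm_2: "weak_norm 2 E m x = (SUP \<phi>\<in>dual_ball E. L2_set (\<lambda>i. norm (\<phi> (x i))) {..<m})"
  unfolding weak_norm_def by (simp only: powr_half_sum)

text \<open>Keeps the supremum in \<open>weak_norm\<close> from ranging over the empty set.\<close>

lemma zero_in_dual_ball:
  assumes "normed_space E"
  shows "(\<lambda>_. 0) \<in> dual_ball E"
  using dual_norm_leI[OF assms, of "\<lambda>_. 0" 1] normed_spaceD(2)[OF assms]
  by (auto simp: dual_ball_def bounded_functional_def linear_functional_def intro: exI[of _ 0])

lemma norm_le_nrm:
  assumes "normed_space E" "\<phi> \<in> dual_ball E" "x \<in> carrier E"
  shows "norm (\<phi> x) \<le> nrm E x"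
proof -
  have "norm (\<phi> x) \<le> dual_norm E \<phi> * nrm E x"
    using assms by (intro norm_le_dual_norm) (auto simp: dual_ball_def)
  also have "\<dots> \<le> 1 * nrm E x"
    using assms by (intro mult_right_mono normed_spaceD(2)) (auto simp: dual_ball_def)
  finally show ?thesis by simp
qed

lemma weak_norm_upper:
  assumes "normed_space E" "\<And>i. i < m \<Longrightarrow> x i \<in> carrier E" "\<phi> \<in> dual_ball E"
  shows "L2_set (\<lambda>i. norm (\<phi> (x i))) {..<m} \<le> weak_norm 2 E m x"
  unfolding weak_norm_2
proof (rule cSUP_upper[OF assms(3)], rule bdd_aboveI2)
  fix \<psi> assume "\<psi> \<in> dual_ball E"
  then show "L2_set (\<lambda>i. norm (\<psi> (x i))) {..<m} \<le> L2_set (\<lambda>i. nrm E (x i)) {..<m}"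
    using assms by (intro L2_set_mono norm_le_nrm) auto
qed

lemma weak_norm_nonneg:
  assumes "normed_space E" "\<And>i. i < m \<Longrightarrow> x i \<in> carrier E"
  shows "0 \<le> weak_norm 2 E m x"
  using weak_norm_upper[OF assms zero_in_dual_ball[OF assms(1)]] by (simp add: L2_set_def)

lemma weak_norm_leI:
  assumes "normed_space E" "\<And>\<phi>. \<phi> \<in> dual_ball E \<Longrightarrow> L2_set (\<lambda>i. norm (\<phi> (x i))) {..<m} \<le> B"
  shows "weak_norm 2 E m x \<le> B"
  unfolding weak_norm_2 using zero_in_dual_ball[OF assms(1)] assms(2)
  by (intro cSUP_least) auto

text \<open>Divided by \<open>C\<close>, the functional lies in the dual ball and competes in the
  supremum. Every use of a weak norm as an upper bound in the estimate of \<open>\<Phi>\<close> goes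
  through this, with coordinates on \<open>X\<close> and scalar products on
  \<open>H\<close>.\<close>

lemma functional_weak_norm:
  fixes E :: "('k::real_normed_field, 'u) nspace"
  assumes E: "normed_space E" and x: "\<And>i. i < m \<Longrightarrow> x i \<in> carrier E"
    and lin: "linear_functional E \<phi>" and C: "\<And>y. y \<in> carrier E \<Longrightarrow> norm (\<phi> y) \<le> C * nrm E y" "0 \<le> C"
  shows "(\<Sum>i<m. (norm (\<phi> (x i)))\<^sup>2) \<le> C\<^sup>2 * (weak_norm 2 E m x)\<^sup>2"
proof (cases "C = 0")
  case True
  then show ?thesis using C(1) x by simp
next
  case False
  then have pos: "0 < C" using C(2) by simp
  define c :: 'k where "c = of_real (inverse C)"
  have nc: "norm c = inverse C"
    using pos by (simp add: c_def norm_inverse)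
  have le: "norm (c * \<phi> y) \<le> 1 * nrm E y" if "y \<in> carrier E" for y
    using C(1)[OF that] pos by (simp add: norm_mult nc field_simps)
  have "(\<lambda>y. c * \<phi> y) \<in> dual_ball E"
    using lin le dual_norm_leI[OF E le]
    by (auto simp: dual_ball_def bounded_functional_def linear_functional_def algebra_simps
        intro: exI[of _ 1])
  from weak_norm_upper[OF E x this]
  have "(L2_set (\<lambda>i. norm (c * \<phi> (x i))) {..<m})\<^sup>2 \<le> (weak_norm 2 E m x)\<^sup>2"
    by (intro power_mono) auto
  then have "(inverse C)\<^sup>2 * (\<Sum>i<m. (norm (\<phi> (x i)))\<^sup>2) \<le> (weak_norm 2 E m x)\<^sup>2"
    by (simp add: L2_set_def sum_nonneg norm_mult nc power_mult_distrib sum_distrib_left)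
  then show ?thesis
    using pos by (simp add: field_simps)
qed

section \<open>Tensor calculus\<close>

text \<open>Equivalent formal sums give the same predicate under \<open>SOME\<close>, hence
  literally the same representative. Equations between tensors are thereby reduced to testing
  against bilinear forms.\<close>

lemma tensor_of_cong: "same_tensor E F l l' \<Longrightarrow> tensor_of E F l = tensor_of E F l'"
  by (simp add: tensor_of_def same_tensor_def)

lemma formal_sum_tensor_of:
  assumes "l \<in> lists (carrier E \<times> carrier F)"
  shows "formal_sum (tensor_of E F l) \<in> lists (carrier E \<times> carrier F)"
    and "same_tensor E F (formal_sum (tensor_of E F l)) l"
  using someI[of "\<lambda>l'. l' \<in> lists (carrier E \<times> carrier F) \<and> same_tensor E F l' l" l] assms
  by (auto simp: tensor_of_def same_tensor_def)

lemma same_tensorD: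
  "same_tensor E F l l' \<Longrightarrow> bilinear_form E F A \<Longrightarrow> (\<Sum>(x, y)\<leftarrow>l. A x y) = (\<Sum>(x, y)\<leftarrow>l'. A x y)"
  by (simp add: same_tensor_def)

lemma carrier_tensor: "carrier (normed_tensor E F \<nu>) = tensor_of E F ` lists (carrier E \<times> carrier F)"
  by (simp add: normed_tensor_def)

lemma nrm_tensor: "nrm (normed_tensor E F \<nu>) = \<nu>"
  by (simp add: normed_tensor_def)

lemma sum_list_map_case_prod:
  "(\<Sum>(x, y)\<leftarrow>map (\<lambda>(x, y). (T x, U y)) l. A x y) = (\<Sum>(x, y)\<leftarrow>l. A (T x) (U y))"
  by (simp add: o_def case_prod_unfold)

lemma bilinear_form_comp:
  assumes "bounded_op E\<^sub>1 E\<^sub>2 T" "bounded_op F\<^sub>1 F\<^sub>2 U" "bilinear_form E\<^sub>2 F\<^sub>2 A"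
  shows "bilinear_form E\<^sub>1 F\<^sub>1 (\<lambda>x y. A (T x) (U y))"
  using assms by (simp add: bilinear_form_def linear_functional_def bounded_op_def Pi_iff)

lemma tensor_map_tensor_of:
  assumes "bounded_op E\<^sub>1 E\<^sub>2 T" "bounded_op F\<^sub>1 F\<^sub>2 U" "l \<in> lists (carrier E\<^sub>1 \<times> carrier F\<^sub>1)"
  shows "tensor_map E\<^sub>2 F\<^sub>2 T U (tensor_of E\<^sub>1 F\<^sub>1 l) = tensor_of E\<^sub>2 F\<^sub>2 (map (\<lambda>(x, y). (T x, U y)) l)"
  unfolding tensor_map_def
  by (intro tensor_of_cong) (use same_tensorD[OF formal_sum_tensor_of(2)[OF assms(3)]
        bilinear_form_comp[OF assms(1,2)]] in \<open>simp add: same_tensor_def sum_list_map_case_prod del: map_map\<close>)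

lemma tensor_add:
  assumes "l \<in> lists (carrier E \<times> carrier F)" "l' \<in> lists (carrier E \<times> carrier F)"
  shows "tensor_of E F l \<oplus>\<^bsub>normed_tensor E F \<nu>\<^esub> tensor_of E F l' = tensor_of E F (l @ l')"
  unfolding normed_tensor_def
  by simp (intro tensor_of_cong, use same_tensorD[OF formal_sum_tensor_of(2)[OF assms(1)]]
      same_tensorD[OF formal_sum_tensor_of(2)[OF assms(2)]] in \<open>simp add: same_tensor_def\<close>)

lemma sum_list_bilinear_smult:
  assumes "bilinear_form E F A" "l \<in> lists (carrier E \<times> carrier F)"
  shows "(\<Sum>(x, y)\<leftarrow>map (\<lambda>(x, y). (c \<odot>\<^bsub>E\<^esub> x, y)) l. A x y) = c * (\<Sum>(x, y)\<leftarrow>l. A x y)"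
  using assms(2)
  by (induction l)
    (use assms(1) in \<open>auto simp: bilinear_form_def linear_functional_def algebra_simps\<close>)

lemma tensor_smult:
  assumes "l \<in> lists (carrier E \<times> carrier F)"
  shows "c \<odot>\<^bsub>normed_tensor E F \<nu>\<^esub> tensor_of E F l
    = tensor_of E F (map (\<lambda>(x, y). (c \<odot>\<^bsub>E\<^esub> x, y)) l)"
proof -
  have "same_tensor E F (map (\<lambda>(x, y). (c \<odot>\<^bsub>E\<^esub> x, y)) (formal_sum (tensor_of E F l)))
      (map (\<lambda>(x, y). (c \<odot>\<^bsub>E\<^esub> x, y)) l)"
    unfolding same_tensor_def
  proof (intro allI impI)
    fix A assume A: "bilinear_form E F A"
    show "(\<Sum>(x, y)\<leftarrow>map (\<lambda>(x, y). (c \<odot>\<^bsub>E\<^esub> x, y)) (formal_sum (tensor_of E F l)). A x y)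
        = (\<Sum>(x, y)\<leftarrow>map (\<lambda>(x, y). (c \<odot>\<^bsub>E\<^esub> x, y)) l. A x y)"
      by (simp only: sum_list_bilinear_smult[OF A] assms formal_sum_tensor_of(1)[OF assms]
          same_tensorD[OF formal_sum_tensor_of(2)[OF assms] A])
  qed
  then show ?thesis
    by (simp add: normed_tensor_def tensor_of_cong)
qed

text \<open>The linear map induced by \<open>A\<close>, read off the stored representative;
  \<open>bilinear_lift_tensor_of\<close> shows that any other formal sum gives the same
  value.\<close>

definition bilinear_lift :: "(('k, 'a) tuniv \<Rightarrow> ('k, 'a) tuniv \<Rightarrow> 'k::real_normed_field) \<Rightarrow> ('k, 'a) tuniv \<Rightarrow> 'k"
  where "bilinear_lift A z = (\<Sum>(x, y)\<leftarrow>formal_sum z. A x y)"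

lemma bilinear_lift_tensor_of:
  assumes "bilinear_form E F A" "l \<in> lists (carrier E \<times> carrier F)"
  shows "bilinear_lift A (tensor_of E F l) = (\<Sum>(x, y)\<leftarrow>l. A x y)"
  unfolding bilinear_lift_def by (rule same_tensorD[OF formal_sum_tensor_of(2)[OF assms(2)] assms(1)])

lemma linear_functional_bilinear_lift:
  assumes A: "bilinear_form E F A" and E: "normed_space E"
  shows "linear_functional (normed_tensor E F \<nu>) (bilinear_lift A)"
proof -
  let ?L = "lists (carrier E \<times> carrier F)"
  have "bilinear_lift A (tensor_of E F l \<oplus>\<^bsub>normed_tensor E F \<nu>\<^esub> tensor_of E F l')
      = bilinear_lift A (tensor_of E F l) + bilinear_lift A (tensor_of E F l')"
    if l: "l \<in> ?L" "l' \<in> ?L" for l l'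
  proof -
    have "l @ l' \<in> ?L" using l by simp
    with l show ?thesis
      unfolding tensor_add[OF l] by (simp add: bilinear_lift_tensor_of[OF A] del: append_in_lists_conv)
  qed
  moreover have "bilinear_lift A (c \<odot>\<^bsub>normed_tensor E F \<nu>\<^esub> tensor_of E F l) = c * bilinear_lift A (tensor_of E F l)"
    if l: "l \<in> ?L" for c l
  proof -
    have "map (\<lambda>(x, y). (c \<odot>\<^bsub>E\<^esub> x, y)) l \<in> ?L"
      using l by (auto simp: in_lists_conv_set normed_space_closed(2)[OF E])
    with l show ?thesis
      unfolding tensor_smult[OF l] by (simp only: bilinear_lift_tensor_of[OF A] sum_list_bilinear_smult[OF A])
  qed
  ultimately show ?thesis
    unfolding linear_functional_def carrier_tensor by blast
qed

lemma linear_functional_tensor_of: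
  assumes L: "linear_functional (normed_tensor E F \<nu>) L" and l: "l \<in> lists (carrier E \<times> carrier F)"
  shows "L (tensor_of E F l) = (\<Sum>(x, y)\<leftarrow>l. L (elem_tensor E F x y))"
  using l
proof (induction l)
  case Nil
  have "L (tensor_of E F [] \<oplus>\<^bsub>normed_tensor E F \<nu>\<^esub> tensor_of E F []) = L (tensor_of E F []) + L (tensor_of E F [])"
    by (intro linear_functional_add[OF L]) (auto simp: carrier_tensor)
  then show ?case
    by (simp add: tensor_add)
next
  case (Cons p l)
  obtain x y where p: "p = (x, y)" by fastforce
  have "L (tensor_of E F [p] \<oplus>\<^bsub>normed_tensor E F \<nu>\<^esub> tensor_of E F l) = L (tensor_of E F [p]) + L (tensor_of E F l)"
    using Cons.hyps by (intro linear_functional_add[OF L]) (auto simp: carrier_tensor)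
  then show ?case
    using Cons by (simp add: tensor_add p elem_tensor_def)
qed

text \<open>Freezing the last factor allows a functional on the threefold product to be evaluated
  where the first factor is itself a sum of elementary tensors, as \<open>R p x\<close> is.\<close>

lemma linear_functional_elem_tensor:
  assumes L: "linear_functional (normed_tensor E F \<nu>) L" and y: "y \<in> carrier F"
  shows "linear_functional E (\<lambda>x. L (elem_tensor E F x y))"
  unfolding linear_functional_def
proof (intro conjI ballI allI)
  fix x x' assume x: "x \<in> carrier E" "x' \<in> carrier E"
  have "elem_tensor E F (x \<oplus>\<^bsub>E\<^esub> x') y = tensor_of E F ([(x, y)] @ [(x', y)])"
    unfolding elem_tensor_def using x y
    by (intro tensor_of_cong) (auto simp: same_tensor_def bilinear_form_def linear_functional_def)
  also have "\<dots> = tensor_of E F [(x, y)] \<oplus>\<^bsub>normed_tensor E F \<nu>\<^esub> tensor_of E F [(x', y)]"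
    by (rule tensor_add[symmetric]) (use x y in auto)
  finally show "L (elem_tensor E F (x \<oplus>\<^bsub>E\<^esub> x') y) = L (elem_tensor E F x y) + L (elem_tensor E F x' y)"
    using linear_functional_add[OF L] x y by (auto simp: elem_tensor_def carrier_tensor)
next
  fix c x assume x: "x \<in> carrier E"
  have "elem_tensor E F (c \<odot>\<^bsub>E\<^esub> x) y = c \<odot>\<^bsub>normed_tensor E F \<nu>\<^esub> tensor_of E F [(x, y)]"
    using x y by (simp add: tensor_smult elem_tensor_def)
  then show "L (elem_tensor E F (c \<odot>\<^bsub>E\<^esub> x) y) = c * L (elem_tensor E F x y)"
    using linear_functional_scale[OF L] x y by (auto simp: elem_tensor_def carrier_tensor)
qed

lemma tensor_normD:
  assumes "tensor_norm \<beta>" "normed_space E" "normed_space F"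
  shows "normed_space (tensor_space \<beta> E F)"
  using assms unfolding tensor_norm_def by blast

lemma tensor_norm_map:
  assumes \<beta>: "tensor_norm \<beta>"
    and sp: "normed_space E\<^sub>1" "normed_space F\<^sub>1" "normed_space E\<^sub>2" "normed_space F\<^sub>2"
    and op: "bounded_op E\<^sub>1 E\<^sub>2 T" "bounded_op F\<^sub>1 F\<^sub>2 U"
    and l: "l \<in> lists (carrier E\<^sub>1 \<times> carrier F\<^sub>1)"
    and le: "op_norm E\<^sub>1 E\<^sub>2 T \<le> C" "op_norm F\<^sub>1 F\<^sub>2 U \<le> 1"
  shows "\<beta> E\<^sub>2 F\<^sub>2 (tensor_of E\<^sub>2 F\<^sub>2 (map (\<lambda>(x, y). (T x, U y)) l)) \<le> C * \<beta> E\<^sub>1 F\<^sub>1 (tensor_of E\<^sub>1 F\<^sub>1 l)"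
proof -
  have z: "tensor_of E\<^sub>1 F\<^sub>1 l \<in> carrier (tensor_space \<beta> E\<^sub>1 F\<^sub>1)"
    using l by (simp add: carrier_tensor)
  have pos: "0 \<le> \<beta> E\<^sub>1 F\<^sub>1 (tensor_of E\<^sub>1 F\<^sub>1 l)"
    using normed_spaceD(2)[OF tensor_normD[OF \<beta> sp(1,2)] z] by (simp add: nrm_tensor)
  have "\<beta> E\<^sub>2 F\<^sub>2 (tensor_map E\<^sub>2 F\<^sub>2 T U (tensor_of E\<^sub>1 F\<^sub>1 l))
      \<le> op_norm E\<^sub>1 E\<^sub>2 T * op_norm F\<^sub>1 F\<^sub>2 U * \<beta> E\<^sub>1 F\<^sub>1 (tensor_of E\<^sub>1 F\<^sub>1 l)"
    using \<beta> sp op z unfolding tensor_norm_def by blast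
  also have "\<dots> \<le> (C * 1) * \<beta> E\<^sub>1 F\<^sub>1 (tensor_of E\<^sub>1 F\<^sub>1 l)"
    using le op_norm_nonneg[OF sp(1,3) op(1)] op_norm_nonneg[OF sp(2,4) op(2)] pos
    by (intro mult_right_mono mult_mono) auto
  finally show ?thesis
    by (simp add: tensor_map_tensor_of[OF op l])
qed

lemma sum_list_concat_map: "(\<Sum>x\<leftarrow>concat (map Q qs). f x) = (\<Sum>q\<leftarrow>qs. \<Sum>x\<leftarrow>Q q. f x)"
  by (induction qs) auto

text \<open>Triangle inequality in the shape needed for averages over a finite family of
  operators.\<close>

lemma tensor_norm_concat:
  assumes \<beta>: "tensor_norm \<beta>" and sp: "normed_space E" "normed_space F"
    and ls: "\<And>l. l \<in> set ls \<Longrightarrow> l \<in> lists (carrier E \<times> carrier F) \<and> \<beta> E F (tensor_of E F l) \<le> C"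
  shows "\<beta> E F (tensor_of E F (concat ls)) \<le> real (length ls) * C"
  using ls
proof (induction ls)
  case Nil
  have "\<beta> E F (tensor_of E F []) = 0"
    using nrm_zero[OF tensor_normD[OF \<beta> sp]] by (simp add: normed_tensor_def)
  then show ?case by simp
next
  case (Cons l ls)
  have l: "l \<in> lists (carrier E \<times> carrier F)" "concat ls \<in> lists (carrier E \<times> carrier F)"
    using Cons.prems by (auto simp: in_lists_conv_set)
  have "\<beta> E F (tensor_of E F (concat (l # ls)))
      \<le> \<beta> E F (tensor_of E F l) + \<beta> E F (tensor_of E F (concat ls))"
    using normed_spaceD(5)[OF tensor_normD[OF \<beta> sp], of "tensor_of E F l" "tensor_of E F (concat ls)"] l
    by (simp add: carrier_tensor nrm_tensor tensor_add)
  also have "\<dots> \<le> C + length ls * C"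
    using Cons by (intro add_mono) auto
  finally show ?case
    by (simp add: algebra_simps)
qed

section \<open>Characters of the cube\<close>

text \<open>The number \<open>s\<close> is a sign vector stored as a bit mask and
  \<open>chi s k\<close> is its sign in place \<open>k\<close>. As functions of \<open>s\<close>
  these are the Rademacher functions.\<close>

definition chi :: "nat \<Rightarrow> nat \<Rightarrow> 'b::ring_1" where
  "chi s k = (if bit s k then -1 else 1)"

lemma norm_chi [simp]: "norm (chi s k :: 'b::real_normed_field) = 1"
  by (simp add: chi_def)

lemma chi_square [simp]: "chi s k * chi s k = (1 :: 'b::ring_1)"
  by (simp add: chi_def)

lemma xor_less_power: "j < 2 ^ p \<Longrightarrow> k < 2 ^ p \<Longrightarrow> xor j k < 2 ^ p" for j k :: nat
  by (simp add: take_bit_nat_eq_self_iff[symmetric])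

lemma xor_cancel [simp]: "xor j (xor j k) = k" "xor (xor k j) j = k" for j k :: nat
  by (simp_all add: xor.assoc xor.assoc[symmetric])

lemma sum_xor:
  fixes k p :: nat
  assumes "k < 2 ^ p"
  shows "(\<Sum>r<2 ^ p. g (xor k r)) = (\<Sum>r<2 ^ p. g r)"
    and "(\<Sum>r<2 ^ p. g (xor r k)) = (\<Sum>r<2 ^ p. g r)"
proof -
  show "(\<Sum>r<2 ^ p. g (xor k r)) = (\<Sum>r<2 ^ p. g r)"
    by (rule sum.reindex_bij_witness[of _ "xor k" "xor k"]) (auto simp: xor_less_power assms)
  then show "(\<Sum>r<2 ^ p. g (xor r k)) = (\<Sum>r<2 ^ p. g r)"
    by (simp add: xor.commute[of _ k])
qed

text \<open>Flipping bit \<open>j\<close> of \<open>s\<close> permutes the index set, reverses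
  \<open>chi s j\<close> and leaves \<open>chi s l\<close> alone for distinct \<open>l\<close>, so
  the sum equals its own negative.\<close>

lemma sum_chi_chi:
  assumes "j < d" "l < d"
  shows "(\<Sum>s<2 ^ d. chi s j * chi s l) = (if j = l then 2 ^ d else 0 :: 'b::real_normed_field)"
proof (cases "j = l")
  case False
  have "(2::nat) ^ j < 2 ^ d" using assms by simp
  have "(\<Sum>s<2 ^ d. chi (xor (2 ^ j) s) j * chi (xor (2 ^ j) s) l)
      = (\<Sum>s<2 ^ d. - (chi s j * chi s l :: 'b))"
    using False by (intro sum.cong refl) (simp add: chi_def bit_xor_iff bit_exp_iff)
  then show ?thesis
    using False sum_xor(1)[OF \<open>(2::nat) ^ j < 2 ^ d\<close>, of "\<lambda>s. chi s j * chi s l :: 'b"]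
    by (simp add: sum_negf equal_neg_zero)
qed (use assms in simp)

text \<open>Bessel's inequality for the Rademacher functions, which are orthogonal with squared norm
  \<open>n\<close>. Here \<open>b\<close> is \<open>n\<close> times the projection of
  \<open>c\<close> onto their span, and expanding the sum of
  \<open>(norm (n *\<^sub>R c s - b s))\<^sup>2\<close> gives the claim. Since the signs are real, a
  real inner product suffices for complex values too.\<close>

lemma bessel_chi_real:
  fixes c :: "nat \<Rightarrow> 'b::real_inner"
  shows "(\<Sum>k<d. (norm (\<Sum>s<2 ^ d. (chi s k :: real) *\<^sub>R c s))\<^sup>2) \<le> 2 ^ d * (\<Sum>s<2 ^ d. (norm (c s))\<^sup>2)"
proof -
  define a where "a k = (\<Sum>s<2 ^ d. (chi s k :: real) *\<^sub>R c s)" for k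
  define n :: real where "n = 2 ^ d"
  define b where "b s = (\<Sum>k<d. (chi s k :: real) *\<^sub>R a k)" for s
  have n: "n > 0" by (simp add: n_def)
  have cross: "(\<Sum>s<2 ^ d. inner (c s) (b s)) = (\<Sum>k<d. (norm (a k))\<^sup>2)"
  proof -
    have "(\<Sum>s<2 ^ d. inner (c s) (b s)) = (\<Sum>s<2 ^ d. \<Sum>k<d. inner ((chi s k :: real) *\<^sub>R c s) (a k))"
      by (simp add: b_def inner_sum_right)
    also have "\<dots> = (\<Sum>k<d. \<Sum>s<2 ^ d. inner ((chi s k :: real) *\<^sub>R c s) (a k))"
      by (rule sum.swap)
    also have "\<dots> = (\<Sum>k<d. inner (a k) (a k))"
      by (simp add: a_def inner_sum_left)
    finally show ?thesis by (simp add: power2_norm_eq_inner)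
  qed
  have "(\<Sum>s<2 ^ d. inner (b s) (b s)) = (\<Sum>s<2 ^ d. \<Sum>k<d. \<Sum>l<d. (chi s k * chi s l) * (inner (a k) (a l)))"
    by (simp add: b_def inner_sum_left inner_sum_right sum_distrib_left mult_ac inner_commute)
  also have "\<dots> = (\<Sum>k<d. \<Sum>s<2 ^ d. \<Sum>l<d. (chi s k * chi s l) * (inner (a k) (a l)))"
    by (rule sum.swap)
  also have "\<dots> = (\<Sum>k<d. \<Sum>l<d. \<Sum>s<2 ^ d. (chi s k * chi s l) * (inner (a k) (a l)))"
    by (intro sum.cong refl sum.swap)
  also have "\<dots> = (\<Sum>k<d. \<Sum>l<d. (if k = l then n else 0) * (inner (a k) (a l)))"
    by (intro sum.cong refl) (simp add: sum_distrib_right[symmetric] sum_chi_chi n_def)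
  also have "\<dots> = (\<Sum>k<d. n * (inner (a k) (a k)))"
    by (intro sum.cong refl) (simp add: if_distrib[of "\<lambda>x. x * _"] cong: if_cong)
  also have "\<dots> = n * (\<Sum>k<d. (norm (a k))\<^sup>2)"
    by (simp add: sum_distrib_left power2_norm_eq_inner)
  finally have sq: "(\<Sum>s<2 ^ d. inner (b s) (b s)) = n * (\<Sum>k<d. (norm (a k))\<^sup>2)" .
  have "0 \<le> (\<Sum>s<2 ^ d. (norm (n *\<^sub>R c s - b s))\<^sup>2)"
    by (simp add: sum_nonneg)
  also have "\<dots> = (\<Sum>s<2 ^ d. n * n * (inner (c s) (c s)) - 2 * n * (inner (c s) (b s)) + inner (b s) (b s))"
    by (simp add: power2_norm_eq_inner inner_diff_left inner_diff_right inner_commute algebra_simps)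
  also have "\<dots> = n * n * (\<Sum>s<2 ^ d. (norm (c s))\<^sup>2) - 2 * n * (\<Sum>s<2 ^ d. inner (c s) (b s)) + (\<Sum>s<2 ^ d. inner (b s) (b s))"
    by (simp add: sum.distrib sum_subtractf sum_distrib_left power2_norm_eq_inner)
  also have "\<dots> = n * (n * (\<Sum>s<2 ^ d. (norm (c s))\<^sup>2) - (\<Sum>k<d. (norm (a k))\<^sup>2))"
    by (simp add: cross sq algebra_simps)
  finally have "(\<Sum>k<d. (norm (a k))\<^sup>2) \<le> n * (\<Sum>s<2 ^ d. (norm (c s))\<^sup>2)"
    using n by (simp add: zero_le_mult_iff)
  then show ?thesis
    by (simp only: a_def n_def)
qed

lemma bessel_chi:
  fixes c :: "nat \<Rightarrow> 'k::{real_normed_field,real_inner}"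
  shows "(\<Sum>k<d. (norm (\<Sum>s<2 ^ d. chi s k * c s))\<^sup>2) \<le> 2 ^ d * (\<Sum>s<2 ^ d. (norm (c s))\<^sup>2)"
proof -
  have "chi s k * c s = (chi s k :: real) *\<^sub>R c s" for s k
    by (simp add: chi_def)
  then show ?thesis
    using bessel_chi_real[of c d] by simp
qed

lemma sum_list_upt: "(\<Sum>i\<leftarrow>[0..<n]. f i) = (\<Sum>i<n. f i)"
  by (simp add: sum_list_distinct_conv_sum_set lessThan_atLeast0)

lemma sum_PiE_3:
  fixes m :: "nat \<Rightarrow> nat"
  shows "(\<Sum>i\<in>(\<Pi>\<^sub>E j\<in>{..<3}. {..<m j}). g (i 0) (i 1) (i 2)) = (\<Sum>a<m 0. \<Sum>b<m 1. \<Sum>c<m 2. g a b c)"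
proof -
  have lt3: "j < 3 \<longleftrightarrow> j = 0 \<or> j = 1 \<or> j = 2" for j :: nat
    by auto
  have "(\<Sum>i\<in>(\<Pi>\<^sub>E j\<in>{..<3}. {..<m j}). g (i 0) (i 1) (i 2))
      = (\<Sum>(a, b, c)\<in>{..<m 0} \<times> {..<m 1} \<times> {..<m 2}. g a b c)"
    by (rule sum.reindex_bij_witness[of _
          "\<lambda>(a, b, c) j. if j = 0 then a else if j = 1 then b else if j = 2 then c else undefined"
          "\<lambda>i. (i 0, i 1, i 2)"])
      (auto simp: lt3 PiE_iff extensional_def fun_eq_iff)
  then show ?thesis
    by (simp add: sum.cartesian_product)
qed

lemma L2_set_leI: "(\<Sum>i\<in>I. (f i)\<^sup>2) \<le> b\<^sup>2 \<Longrightarrow> 0 \<le> b \<Longrightarrow> L2_set f I \<le> b"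
  unfolding L2_set_def by (rule real_le_lsqrt)

lemma listset_2: "xs \<in> listset [A, B] \<longleftrightarrow> (\<exists>x\<in>A. \<exists>y\<in>B. xs = [x, y])"
  by (auto simp: set_Cons_def)

lemma listset_3: "xs \<in> listset [A, B, C] \<longleftrightarrow> (\<exists>x\<in>A. \<exists>y\<in>B. \<exists>z\<in>C. xs = [x, y, z])"
  by (auto simp: set_Cons_def)

section \<open>Tensor products of sequence spaces\<close>

locale tensor_universe =
  fixes enc :: "(nat \<Rightarrow> 'k::{real_normed_field,real_inner,banach}) \<Rightarrow> ('k, 'a) tuniv"
  assumes inj: "inj enc"
begin

sublocale ell2: seq_norm "\<lambda>n f. L2_set (\<lambda>i. norm (f i)) {..<n}" enc
  by (rule seq_norm_ell2[OF inj])

sublocale linf: seq_norm "\<lambda>n f. norm (f n)" enc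
  by (rule seq_norm_linf[OF inj])

abbreviation "H \<equiv> ell2 enc"
abbreviation "X \<equiv> linf enc"
abbreviation "dec \<equiv> the_inv enc"

lemma enc_dec: "x \<in> carrier H \<Longrightarrow> enc (dec x) = x" "x \<in> carrier X \<Longrightarrow> enc (dec x) = x"
  by (auto simp: seq_space_def the_inv_f_f inj)

lemma dec_add [simp]: "dec (x \<oplus>\<^bsub>H\<^esub> y) = (\<lambda>i. dec x i + dec y i)" "dec (x \<oplus>\<^bsub>X\<^esub> y) = (\<lambda>i. dec x i + dec y i)"
  by (simp_all add: seq_space_def the_inv_f_f inj)

lemma dec_smult [simp]: "dec (c \<odot>\<^bsub>H\<^esub> x) = (\<lambda>i. c * dec x i)" "dec (c \<odot>\<^bsub>X\<^esub> x) = (\<lambda>i. c * dec x i)"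
  by (simp_all add: seq_space_def the_inv_f_f inj)

lemma L2_set_dec_le: "x \<in> carrier H \<Longrightarrow> L2_set (\<lambda>i. norm (dec x i)) {..<n} \<le> nrm H x"
  using ell2.le_nrm[of "dec x" n] by (simp add: enc_dec)

lemma norm_dec_le: "x \<in> carrier H \<Longrightarrow> norm (dec x i) \<le> nrm H x"
  using ell2.coord_le_nrm[of "dec x" i] by (simp add: enc_dec)

lemma norm_dec_le_linf: "x \<in> carrier X \<Longrightarrow> norm (dec x i) \<le> nrm X x"
  using linf.coord_le_nrm[of "dec x" i] by (simp add: enc_dec)

text \<open>Truncation keeps vectors in the finite span of the \<open>e k\<close>. Equality of
  tensors is tested on all bilinear forms, continuous or not, so only finite expansions are
  available.\<close>

definition vec :: "nat \<Rightarrow> (nat \<Rightarrow> 'k) \<Rightarrow> ('k, 'a) tuniv" where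
  "vec d u = enc (\<lambda>i. if i < d then u i else 0)"

definition e :: "nat \<Rightarrow> ('k, 'a) tuniv" where
  "e k = enc (\<lambda>i. if i = k then 1 else 0)"

lemma dec_vec [simp]: "dec (vec d u) i = (if i < d then u i else 0)"
  by (simp add: vec_def the_inv_f_f inj)

lemma dec_e [simp]: "dec (e k) i = (if i = k then 1 else 0)"
  by (simp add: e_def the_inv_f_f inj)

lemma L2_set_vec_le:
  fixes d n :: nat
  shows "L2_set (\<lambda>i. norm (if i < d then u i else (0::'k))) {..<n} \<le> L2_set (\<lambda>i. norm (u i)) {..<d}"
proof -
  have "(\<Sum>i<n. (norm (if i < d then u i else 0))\<^sup>2) = (\<Sum>i\<in>{..<n} \<inter> {..<d}. (norm (u i))\<^sup>2)"
    by (intro sum.mono_neutral_cong_right) auto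
  also have "\<dots> \<le> (\<Sum>i<d. (norm (u i))\<^sup>2)"
    by (intro sum_mono2) auto
  finally show ?thesis by (simp add: L2_set_def)
qed

lemma vec_in_carrier: "vec d u \<in> carrier H"
  unfolding vec_def by (rule ell2.in_carrierI[OF L2_set_vec_le])

lemma nrm_vec_le: "nrm H (vec d u) \<le> L2_set (\<lambda>i. norm (u i)) {..<d}"
  unfolding vec_def by (rule ell2.nrm_leI[OF L2_set_vec_le])

lemma e_eq_vec: "e k = vec (Suc k) (\<lambda>i. if i = k then 1 else 0)"
  by (auto simp: e_def vec_def intro!: arg_cong[of _ _ enc] ext)

lemma e_in_carrier: "e k \<in> carrier H"
  by (simp add: e_eq_vec vec_in_carrier)

lemma functional_vec:
  assumes \<phi>: "linear_functional H \<phi>"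
  shows "\<phi> (vec d u) = (\<Sum>k<d. u k * \<phi> (e k))"
proof (induction d)
  case 0
  have "vec 0 u = 0 \<odot>\<^bsub>H\<^esub> e 0"
    by (simp add: vec_def e_def ell2.smult_enc)
  then show ?case
    by (simp add: linear_functional_scale[OF \<phi> e_in_carrier])
next
  case (Suc d)
  have "vec (Suc d) u = vec d u \<oplus>\<^bsub>H\<^esub> (u d \<odot>\<^bsub>H\<^esub> e d)"
    by (auto simp: vec_def e_def ell2.smult_enc ell2.add_enc less_Suc_eq intro!: arg_cong[of _ _ enc] ext)
  then show ?case
    using Suc by (simp add: linear_functional_add[OF \<phi> vec_in_carrier] linear_functional_scale[OF \<phi> e_in_carrier]
        normed_space_closed(2)[OF ell2.normed_space_S e_in_carrier])
qed

lemma bilinear_vec: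
  assumes A: "bilinear_form H H A"
  shows "A (vec d u) (vec d v) = (\<Sum>k<d. \<Sum>l<d. u k * v l * A (e k) (e l))"
proof -
  have 1: "linear_functional H (\<lambda>x. A x (vec d v))" and 2: "linear_functional H (A (e k))" for k
    using A vec_in_carrier e_in_carrier by (auto simp: bilinear_form_def)
  have "A (vec d u) (vec d v) = (\<Sum>k<d. u k * A (e k) (vec d v))"
    by (rule functional_vec[OF 1])
  also have "\<dots> = (\<Sum>k<d. \<Sum>l<d. u k * v l * A (e k) (e l))"
    by (simp add: functional_vec[OF 2] sum_distrib_left mult.assoc)
  finally show ?thesis .
qed

text \<open>The monomial unitaries of dimension \<open>2 ^ p\<close>: exclusive-or makes \<open>{..<2 ^ p}\<close> a group.\<close>

definition G :: "nat \<Rightarrow> nat \<Rightarrow> nat \<Rightarrow> ('k, 'a) tuniv \<Rightarrow> ('k, 'a) tuniv" where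
  "G p r s x = vec (2 ^ p) (\<lambda>k. chi s k * dec x (xor k r))"

lemma nrm_G_le:
  assumes "r < 2 ^ p" "x \<in> carrier H"
  shows "nrm H (G p r s x) \<le> 1 * nrm H x"
proof -
  have "L2_set (\<lambda>k. norm (chi s k * dec x (xor k r))) {..<2 ^ p} = L2_set (\<lambda>i. norm (dec x i)) {..<2 ^ p}"
    using sum_xor(2)[OF assms(1), of "\<lambda>i. (norm (dec x i))\<^sup>2"] by (simp add: L2_set_def norm_mult)
  then show ?thesis
    unfolding G_def using L2_set_dec_le[OF assms(2), of "2 ^ p"]
    by (intro order_trans[OF nrm_vec_le]) simp
qed

lemma G_linear:
  "G p r s (x \<oplus>\<^bsub>H\<^esub> y) = G p r s x \<oplus>\<^bsub>H\<^esub> G p r s y"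
  "G p r s (c \<odot>\<^bsub>H\<^esub> x) = c \<odot>\<^bsub>H\<^esub> G p r s x"
  by (auto simp: G_def vec_def ell2.add_enc ell2.smult_enc algebra_simps
      intro!: arg_cong[of _ _ enc] ext)

lemma G_in_carrier: "G p r s x \<in> carrier H"
  by (simp add: G_def vec_in_carrier)

lemma bounded_op_G: "r < 2 ^ p \<Longrightarrow> bounded_op H H (G p r s)"
  unfolding bounded_op_def using nrm_G_le[of r p _ s]
  by (intro conjI exI[of _ 1]) (auto simp: G_linear G_in_carrier)

text \<open>Coordinates of \<open>X\<close> are indexed by the pairs \<open>(r, s)\<close>; \<open>U p x\<close> sends the \<open>k\<close>-th unit vector to the
  function \<open>(r, s) \<mapsto> (G p r s x)\<^sub>k\<close>.\<close>

definition U :: "nat \<Rightarrow> ('k, 'a) tuniv \<Rightarrow> ('k, 'a) tuniv \<Rightarrow> ('k, 'a) tuniv" where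
  "U p x h = enc (\<lambda>n. case prod_decode n of (r, s) \<Rightarrow>
     if r < 2 ^ p then \<Sum>k<2 ^ p. dec h k * chi s k * dec x (xor k r) else 0)"

lemma dec_U:
  "r < 2 ^ p \<Longrightarrow> dec (U p x h) (prod_encode (r, s)) = (\<Sum>k<2 ^ p. dec h k * chi s k * dec x (xor k r))"
  by (simp add: U_def the_inv_f_f inj)

text \<open>The coordinate (r, s) pairs \<open>h\<close> with \<open>G p r s x\<close>, and
  \<open>G\<close> does not increase the norm, so Cauchy-Schwarz gives a bound free of
  \<open>p\<close>. The supremum norm of \<open>X\<close> takes all these pairings together at no
  extra cost.\<close>

lemma U_coord_le:
  assumes x: "x \<in> carrier H" and h: "h \<in> carrier H"
  shows "norm (case prod_decode n of (r, s) \<Rightarrow>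
     if r < 2 ^ p then \<Sum>k<2 ^ p. dec h k * chi s k * dec x (xor k r) else 0) \<le> nrm H x * nrm H h"
proof -
  obtain r s where rs: "prod_decode n = (r, s)" by fastforce
  show ?thesis
  proof (cases "r < 2 ^ p")
    case True
    have "norm (\<Sum>k<2 ^ p. dec h k * chi s k * dec x (xor k r))
        \<le> (\<Sum>k<2 ^ p. norm (dec h k * chi s k * dec x (xor k r)))"
      by (rule norm_sum)
    also have "\<dots> = (\<Sum>k<2 ^ p. \<bar>norm (dec h k)\<bar> * \<bar>norm (chi s k * dec x (xor k r))\<bar>)"
      by (simp add: norm_mult)
    also have "\<dots> \<le> L2_set (\<lambda>k. norm (dec h k)) {..<2 ^ p} * L2_set (\<lambda>k. norm (chi s k * dec x (xor k r))) {..<2 ^ p}"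
      by (rule L2_set_mult_ineq)
    also have "L2_set (\<lambda>k. norm (chi s k * dec x (xor k r))) {..<2 ^ p} = L2_set (\<lambda>i. norm (dec x i)) {..<2 ^ p}"
      using sum_xor(2)[OF True, of "\<lambda>i. (norm (dec x i))\<^sup>2"] by (simp add: L2_set_def norm_mult)
    also have "L2_set (\<lambda>k. norm (dec h k)) {..<2 ^ p} * L2_set (\<lambda>i. norm (dec x i)) {..<2 ^ p} \<le> nrm H h * nrm H x"
      by (intro mult_mono L2_set_dec_le x h L2_set_nonneg) (rule normed_spaceD(2)[OF ell2.normed_space_S h])
    finally show ?thesis using True by (simp add: rs mult.commute)
  qed (simp add: rs normed_spaceD(2)[OF ell2.normed_space_S] x h)
qed

lemma U_in_carrier: "x \<in> carrier H \<Longrightarrow> h \<in> carrier H \<Longrightarrow> U p x h \<in> carrier X"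
  unfolding U_def by (rule linf.in_carrierI[OF U_coord_le])

lemma nrm_U_le: "x \<in> carrier H \<Longrightarrow> h \<in> carrier H \<Longrightarrow> nrm X (U p x h) \<le> nrm H x * nrm H h"
  unfolding U_def by (rule linf.nrm_leI[OF U_coord_le])

lemma U_linear:
  "U p x (h \<oplus>\<^bsub>H\<^esub> h') = U p x h \<oplus>\<^bsub>X\<^esub> U p x h'"
  "U p x (c \<odot>\<^bsub>H\<^esub> h) = c \<odot>\<^bsub>X\<^esub> U p x h"
  "U p (x \<oplus>\<^bsub>H\<^esub> x') h = U p x h \<oplus>\<^bsub>X\<^esub> U p x' h"
  "U p (c \<odot>\<^bsub>H\<^esub> x) h = c \<odot>\<^bsub>X\<^esub> U p x h"
  by (auto simp: U_def linf.add_enc linf.smult_enc algebra_simps sum.distrib sum_distrib_left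
      split: prod.splits intro!: arg_cong[of _ _ enc] ext)

lemma bounded_op_U: "x \<in> carrier H \<Longrightarrow> bounded_op H X (U p x)"
  unfolding bounded_op_def using nrm_U_le by (auto simp: U_linear U_in_carrier)

section \<open>The trace form, the diagonal tensor and averaging\<close>

definition B :: "nat \<Rightarrow> ('k, 'a) tuniv \<Rightarrow> ('k, 'a) tuniv \<Rightarrow> 'k" where
  "B p x y = (\<Sum>i<2 ^ p. dec x i * dec y i)"

lemma bilinear_form_B: "bilinear_form H H (B p)"
  by (auto simp: bilinear_form_def linear_functional_def B_def algebra_simps sum.distrib sum_distrib_left)

text \<open>As a tensor this is sqrt(d) times the tensor t of the overview, with d = 2^p.\<close>

definition diag :: "nat \<Rightarrow> (('k, 'a) tuniv \<times> ('k, 'a) tuniv) list" where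
  "diag p = map (\<lambda>i. (e i, e i)) [0..<2 ^ p]"

lemma diag_in_lists: "diag p \<in> lists (carrier H \<times> carrier H)"
  by (auto simp: diag_def e_in_carrier)

lemma sum_list_diag: "(\<Sum>(x, y)\<leftarrow>diag p. A x y) = (\<Sum>i<2 ^ p. A (e i) (e i))"
  by (simp add: diag_def o_def sum_list_upt)

text \<open>Summing over the signs \<open>s\<close> kills all terms off the diagonal. For each
  remaining \<open>k\<close>, summing over \<open>r\<close> moves \<open>xor k r\<close> through all
  indices and turns the coordinates into \<open>B p x y\<close>, independently of
  \<open>k\<close>.\<close>

lemma sum_G:
  assumes A: "bilinear_form H H A"
  shows "(\<Sum>r<2 ^ p. \<Sum>s<2 ^ 2 ^ p. A (G p r s x) (G p r s y))
    = 2 ^ 2 ^ p * B p x y * (\<Sum>i<2 ^ p. A (e i) (e i))"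
proof -
  have "(\<Sum>s<2 ^ 2 ^ p. A (G p r s x) (G p r s y))
      = 2 ^ 2 ^ p * (\<Sum>k<2 ^ p. dec x (xor k r) * dec y (xor k r) * A (e k) (e k))" for r
  proof -
    let ?a = "\<lambda>k l. dec x (xor k r) * dec y (xor l r) * A (e k) (e l)"
    have "(\<Sum>s<2 ^ 2 ^ p. A (G p r s x) (G p r s y))
        = (\<Sum>s<2 ^ 2 ^ p. \<Sum>k<2 ^ p. \<Sum>l<2 ^ p. (chi s k * chi s l) * ?a k l)"
      by (simp add: G_def bilinear_vec[OF A] mult_ac)
    also have "\<dots> = (\<Sum>k<2 ^ p. \<Sum>s<2 ^ 2 ^ p. \<Sum>l<2 ^ p. (chi s k * chi s l) * ?a k l)"
      by (rule sum.swap)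
    also have "\<dots> = (\<Sum>k<2 ^ p. \<Sum>l<2 ^ p. \<Sum>s<2 ^ 2 ^ p. (chi s k * chi s l) * ?a k l)"
      by (intro sum.cong refl sum.swap)
    also have "\<dots> = (\<Sum>k<2 ^ p. \<Sum>l<2 ^ p. (if k = l then 2 ^ 2 ^ p else 0) * ?a k l)"
      by (intro sum.cong refl) (simp add: sum_distrib_right[symmetric] sum_chi_chi)
    also have "\<dots> = (\<Sum>k<2 ^ p. 2 ^ 2 ^ p * ?a k k)"
      by (intro sum.cong refl) (simp add: if_distrib[of "\<lambda>x. x * _"] cong: if_cong)
    finally show ?thesis by (simp add: sum_distrib_left)
  qed
  then have "(\<Sum>r<2 ^ p. \<Sum>s<2 ^ 2 ^ p. A (G p r s x) (G p r s y))
      = 2 ^ 2 ^ p * (\<Sum>r<2 ^ p. \<Sum>k<2 ^ p. dec x (xor k r) * dec y (xor k r) * A (e k) (e k))"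
    by (simp add: sum_distrib_left)
  also have "(\<Sum>r<2 ^ p. \<Sum>k<2 ^ p. dec x (xor k r) * dec y (xor k r) * A (e k) (e k))
      = (\<Sum>k<2 ^ p. \<Sum>r<2 ^ p. dec x (xor k r) * dec y (xor k r) * A (e k) (e k))"
    by (rule sum.swap)
  also have "\<dots> = (\<Sum>k<2 ^ p. B p x y * A (e k) (e k))"
  proof (intro sum.cong refl)
    fix k :: nat assume "k \<in> {..<2 ^ p}"
    then show "(\<Sum>r<2 ^ p. dec x (xor k r) * dec y (xor k r) * A (e k) (e k)) = B p x y * A (e k) (e k)"
      using sum_xor(1)[of k p "\<lambda>i. dec x i * dec y i"] by (simp add: B_def sum_distrib_right[symmetric])
  qed
  finally show ?thesis
    by (simp add: sum_distrib_left mult.assoc)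
qed

text \<open>Averaging \<open>G p r s \<otimes> G p r s\<close> over the group projects onto the line spanned by the diagonal
  tensor.  This replaces the Hahn--Banach theorem: it exhibits a norming functional of that
  tensor.\<close>

lemma norm_lift_B_le:
  assumes \<beta>: "tensor_norm \<beta>" and w: "w \<in> carrier (tensor_space \<beta> H H)"
  shows "norm (bilinear_lift (B p) w) * \<beta> H H (tensor_of H H (diag p)) \<le> 2 ^ p * \<beta> H H w"
proof -
  note sp = ell2.normed_space_S
  obtain l where l: "l \<in> lists (carrier H \<times> carrier H)" and wl: "w = tensor_of H H l"
    using w by (auto simp: carrier_tensor)
  define Q where "Q = (\<lambda>(r, s). map (\<lambda>(x, y). (G p r s x, G p r s y)) l)"
  define ls where "ls = map Q (List.product [0..<2 ^ p] [0..<2 ^ 2 ^ p])"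
  \<comment> \<open>The coefficient that \<open>sum_G\<close> yields when all operators are
    summed.\<close>
  define c :: 'k where "c = 2 ^ 2 ^ p * bilinear_lift (B p) w"
  have "same_tensor H H (concat ls) (map (\<lambda>(x, y). (c \<odot>\<^bsub>H\<^esub> x, y)) (diag p))"
    unfolding same_tensor_def
  proof (intro allI impI)
    fix A assume A: "bilinear_form H H A"
    have "(\<Sum>(x, y)\<leftarrow>concat ls. A x y) = (\<Sum>q\<leftarrow>List.product [0..<2 ^ p] [0..<2 ^ 2 ^ p]. \<Sum>(x, y)\<leftarrow>Q q. A x y)"
      unfolding ls_def by (rule sum_list_concat_map)
    also have "\<dots> = (\<Sum>q\<in>{..<2 ^ p} \<times> {..<2 ^ 2 ^ p}. \<Sum>(x, y)\<leftarrow>Q q. A x y)"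
      by (subst sum_list_distinct_conv_sum_set) (auto simp: distinct_product lessThan_atLeast0)
    also have "\<dots> = (\<Sum>r<2 ^ p. \<Sum>s<2 ^ 2 ^ p. \<Sum>(x, y)\<leftarrow>l. A (G p r s x) (G p r s y))"
      unfolding sum.cartesian_product Q_def
      by (intro sum.cong refl) (auto simp: sum_list_map_case_prod simp del: map_map)
    also have "\<dots> = (\<Sum>(x, y)\<leftarrow>l. \<Sum>r<2 ^ p. \<Sum>s<2 ^ 2 ^ p. A (G p r s x) (G p r s y))"
      by (induction l) (auto simp: sum.distrib)
    also have "\<dots> = (\<Sum>(x, y)\<leftarrow>l. 2 ^ 2 ^ p * B p x y * (\<Sum>i<2 ^ p. A (e i) (e i)))"
      by (simp add: sum_G[OF A])
    also have "\<dots> = 2 ^ 2 ^ p * (\<Sum>(x, y)\<leftarrow>l. B p x y) * (\<Sum>i<2 ^ p. A (e i) (e i))"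
      by (induction l) (auto simp: algebra_simps)
    also have "\<dots> = (\<Sum>(x, y)\<leftarrow>map (\<lambda>(x, y). (c \<odot>\<^bsub>H\<^esub> x, y)) (diag p). A x y)"
      by (simp only: sum_list_bilinear_smult[OF A diag_in_lists] sum_list_diag c_def wl
          bilinear_lift_tensor_of[OF bilinear_form_B l])
    finally show "(\<Sum>(x, y)\<leftarrow>concat ls. A x y) = (\<Sum>(x, y)\<leftarrow>map (\<lambda>(x, y). (c \<odot>\<^bsub>H\<^esub> x, y)) (diag p). A x y)" .
  qed
  then have eq: "tensor_of H H (concat ls) = c \<odot>\<^bsub>tensor_space \<beta> H H\<^esub> tensor_of H H (diag p)"
    by (simp add: tensor_of_cong tensor_smult[OF diag_in_lists])
  have "\<beta> H H (tensor_of H H (concat ls)) \<le> length ls * \<beta> H H w"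
  proof (rule tensor_norm_concat[OF \<beta> sp sp])
    fix l' assume "l' \<in> set ls"
    then obtain r s where r: "r < 2 ^ p" and l': "l' = map (\<lambda>(x, y). (G p r s x, G p r s y)) l"
      unfolding ls_def Q_def by (auto simp del: map_eq_conv)
    have "op_norm H H (G p r s) \<le> 1"
      by (rule op_norm_leI[OF sp nrm_G_le[OF r]]) simp_all
    then have "\<beta> H H (tensor_of H H l') \<le> 1 * \<beta> H H w"
      unfolding wl l' by (intro tensor_norm_map \<beta> sp bounded_op_G r l)
    moreover have "l' \<in> lists (carrier H \<times> carrier H)"
      using l by (auto simp: l' G_in_carrier in_lists_conv_set)
    ultimately show "l' \<in> lists (carrier H \<times> carrier H) \<and> \<beta> H H (tensor_of H H l') \<le> \<beta> H H w"
      by simp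
  qed
  \<comment> \<open>There are 2^p shifts and 2^(2^p) sign vectors. The second number also occurs in
    \<open>c\<close> and cancels, which leaves the factor 2^p of the claim.\<close>
  also have "length ls = 2 ^ p * 2 ^ 2 ^ p"
    by (simp add: ls_def length_product)
  finally have "norm c * \<beta> H H (tensor_of H H (diag p)) \<le> 2 ^ p * 2 ^ 2 ^ p * \<beta> H H w"
    using normed_spaceD(4)[OF tensor_normD[OF \<beta> sp sp], of "tensor_of H H (diag p)" c] diag_in_lists
    by (simp add: eq carrier_tensor nrm_tensor)
  then show ?thesis
    by (simp add: c_def norm_mult norm_power mult_ac)
qed

section \<open>Weak 2-norms of sequences in \<open>H\<close> and \<open>X\<close>\<close>

lemma weak_norm_e_le: "weak_norm 2 H d e \<le> 1"
proof (rule weak_norm_leI[OF ell2.normed_space_S])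
  fix \<phi> assume \<phi>: "\<phi> \<in> dual_ball H"
  define t where "t = L2_set (\<lambda>k. norm (\<phi> (e k))) {..<d}"
  \<comment> \<open>The scalar \<open>\<bar>a\<bar>\<^sup>2 / a\<close> serves as the conjugate of \<open>a\<close>, also for \<open>a = 0\<close>.\<close>
  define v where "v = vec d (\<lambda>k. of_real ((norm (\<phi> (e k)))\<^sup>2) / \<phi> (e k))"
  have t2: "t\<^sup>2 = (\<Sum>k<d. (norm (\<phi> (e k)))\<^sup>2)"
    by (simp add: t_def L2_set_def sum_nonneg)
  have "linear_functional H \<phi>"
    using \<phi> by (simp add: dual_ball_def bounded_functional_def)
  then have "\<phi> v = (\<Sum>k<d. of_real ((norm (\<phi> (e k)))\<^sup>2) / \<phi> (e k) * \<phi> (e k))"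
    unfolding v_def by (rule functional_vec)
  also have "\<dots> = (\<Sum>k<d. of_real ((norm (\<phi> (e k)))\<^sup>2))"
    by (intro sum.cong refl) simp
  also have "\<dots> = of_real (t\<^sup>2)"
    by (simp add: t2)
  finally have "norm (\<phi> v) = t\<^sup>2"
    by (simp add: norm_power)
  moreover have "norm (\<phi> v) \<le> nrm H v"
    unfolding v_def by (rule norm_le_nrm[OF ell2.normed_space_S \<phi> vec_in_carrier])
  moreover have "nrm H v \<le> t"
  proof -
    have "norm (of_real ((norm a)\<^sup>2) / a) = norm a" for a :: 'k
      by (simp add: norm_divide norm_power) (simp add: power2_eq_square)
    then show ?thesis
      using nrm_vec_le[of d "\<lambda>k. of_real ((norm (\<phi> (e k)))\<^sup>2) / \<phi> (e k)"]
      unfolding v_def t_def by simp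
  qed
  \<comment> \<open>The facts chain to \<open>t\<^sup>2\<close> = norm of \<open>\<phi> v\<close>
    \<le> \<open>nrm H v\<close> \<le> \<open>t\<close>; for t = 0 the goal is trivial, otherwise
    one factor cancels.\<close>
  ultimately have "t * t \<le> 1 * t"
    by (simp add: power2_eq_square)
  then show "L2_set (\<lambda>k. norm (\<phi> (e k))) {..<d} \<le> 1"
    unfolding t_def[symmetric] using mult_le_cancel_right[of t t 1] by fastforce
qed

text \<open>By Cauchy-Schwarz the functional with coefficients \<open>u\<close> is bounded by their
  l_2 norm. This sums out one Hilbert space variable of the trilinear form, at the price of the l_2
  norm of what multiplies it.\<close>

lemma sum_functional_le:
  assumes z: "\<And>c. c < m \<Longrightarrow> z c \<in> carrier H"
  shows "(\<Sum>c<m. (norm (\<Sum>i<d. u i * dec (z c) i))\<^sup>2) \<le> (\<Sum>i<d. (norm (u i))\<^sup>2) * (weak_norm 2 H m z)\<^sup>2"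
proof -
  have "norm (\<Sum>i<d. u i * dec y i) \<le> L2_set (\<lambda>i. norm (u i)) {..<d} * nrm H y" if y: "y \<in> carrier H" for y
  proof -
    have "norm (\<Sum>i<d. u i * dec y i) \<le> (\<Sum>i<d. norm (u i * dec y i))"
      by (rule norm_sum)
    also have "\<dots> = (\<Sum>i<d. \<bar>norm (u i)\<bar> * \<bar>norm (dec y i)\<bar>)"
      by (simp add: norm_mult)
    also have "\<dots> \<le> L2_set (\<lambda>i. norm (u i)) {..<d} * L2_set (\<lambda>i. norm (dec y i)) {..<d}"
      by (rule L2_set_mult_ineq)
    also have "\<dots> \<le> L2_set (\<lambda>i. norm (u i)) {..<d} * nrm H y"
      by (intro mult_left_mono L2_set_dec_le y L2_set_nonneg)
    finally show ?thesis .
  qed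
  moreover have "linear_functional H (\<lambda>y. \<Sum>i<d. u i * dec y i)"
    by (auto simp: linear_functional_def algebra_simps sum.distrib sum_distrib_left)
  ultimately show ?thesis
    using functional_weak_norm[OF ell2.normed_space_S z,
        where \<phi> = "\<lambda>y. \<Sum>i<d. u i * dec y i" and C = "L2_set (\<lambda>i. norm (u i)) {..<d}"]
    by (simp add: L2_set_def sum_nonneg)
qed

lemma sum_eval_le:
  assumes "\<And>a. a < m \<Longrightarrow> x a \<in> carrier X"
  shows "(\<Sum>a<m. (norm (dec (x a) n))\<^sup>2) \<le> (weak_norm 2 X m x)\<^sup>2"
proof -
  have "linear_functional X (\<lambda>y. dec y n)"
    by (simp add: linear_functional_def)
  then show ?thesis
    using functional_weak_norm[OF linf.normed_space_S assms, where \<phi> = "\<lambda>y. dec y n" and C = 1] norm_dec_le_linf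
    by simp
qed

section \<open>The trilinear form\<close>

text \<open>The matrix entry \<open>M p i k c\<close> averages \<open>c\<close> against the entry \<open>(k, i)\<close> of \<open>G p r s\<close>, which is
  nonzero only for \<open>r = xor i k\<close>.\<close>

definition M :: "nat \<Rightarrow> nat \<Rightarrow> nat \<Rightarrow> ('k, 'a) tuniv \<Rightarrow> 'k" where
  "M p i k c = of_real (1 / (sqrt (2 ^ p) * 2 ^ 2 ^ p))
     * (\<Sum>s<2 ^ 2 ^ p. chi s k * dec c (prod_encode (xor i k, s)))"

text \<open>With d = 2^p the constant in \<open>M\<close> is sqrt(d) / (d 2^d): an average over d
  2^d pairs against entries scaled by sqrt(d). For fixed \<open>k\<close> the index
  \<open>xor i k\<close> runs through all \<open>r\<close>, and for each \<open>r\<close> Bessel's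
  inequality applies in \<open>s\<close>. The right-hand side is the mean square of the coordinates
  of \<open>c\<close> over these pairs.\<close>

lemma sum_M_le:
  "(\<Sum>i<2 ^ p. \<Sum>k<2 ^ p. (norm (M p i k c))\<^sup>2)
    \<le> 1 / (2 ^ p * 2 ^ 2 ^ p) * (\<Sum>r<2 ^ p. \<Sum>s<2 ^ 2 ^ p. (norm (dec c (prod_encode (r, s))))\<^sup>2)"
proof -
  define \<kappa> :: real where "\<kappa> = 1 / (sqrt (2 ^ p) * 2 ^ 2 ^ p)"
  define f where "f k r = (norm (\<Sum>s<2 ^ 2 ^ p. chi s k * dec c (prod_encode (r, s))))\<^sup>2" for k r
  have \<kappa>: "\<kappa>\<^sup>2 * 2 ^ 2 ^ p = 1 / (2 ^ p * 2 ^ 2 ^ p)"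
    by (simp add: \<kappa>_def power_divide power_mult_distrib) (simp add: power2_eq_square)
  have "(\<Sum>i<2 ^ p. \<Sum>k<2 ^ p. (norm (M p i k c))\<^sup>2) = (\<Sum>i<2 ^ p. \<Sum>k<2 ^ p. \<kappa>\<^sup>2 * f k (xor i k))"
    unfolding M_def f_def \<kappa>_def[symmetric] by (simp add: norm_mult power_mult_distrib)
  also have "\<dots> = (\<Sum>k<2 ^ p. \<Sum>i<2 ^ p. \<kappa>\<^sup>2 * f k (xor i k))"
    by (rule sum.swap)
  also have "\<dots> = (\<Sum>k<2 ^ p. \<Sum>r<2 ^ p. \<kappa>\<^sup>2 * f k r)"
    by (intro sum.cong refl sum_xor(2)[where g = "\<lambda>r. \<kappa>\<^sup>2 * f _ r"]) simp
  also have "\<dots> = (\<Sum>r<2 ^ p. \<kappa>\<^sup>2 * (\<Sum>k<2 ^ p. f k r))"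
    by (subst sum.swap) (simp add: sum_distrib_left)
  also have "\<dots> \<le> (\<Sum>r<2 ^ p. \<kappa>\<^sup>2 * (2 ^ 2 ^ p * (\<Sum>s<2 ^ 2 ^ p. (norm (dec c (prod_encode (r, s))))\<^sup>2)))"
    unfolding f_def by (intro sum_mono mult_left_mono bessel_chi) simp
  also have "\<dots> = \<kappa>\<^sup>2 * 2 ^ 2 ^ p * (\<Sum>r<2 ^ p. \<Sum>s<2 ^ 2 ^ p. (norm (dec c (prod_encode (r, s))))\<^sup>2)"
    by (simp add: sum_distrib_left mult.assoc)
  finally show ?thesis
    unfolding \<kappa> .
qed

text \<open>Coordinate evaluations have norm at most 1 on \<open>X\<close>, so after exchanging sums
  each evaluation contributes at most the squared weak norm. A mean of such terms obeys the same
  bound, whatever \<open>p\<close> is; the factorization through a probability measure is what makes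
  m 2-summing with constant 1.\<close>

lemma sum_sum_M_le:
  assumes "\<And>a. a < m \<Longrightarrow> x a \<in> carrier X"
  shows "(\<Sum>a<m. \<Sum>i<2 ^ p. \<Sum>k<2 ^ p. (norm (M p i k (x a)))\<^sup>2) \<le> (weak_norm 2 X m x)\<^sup>2"
proof -
  have "(\<Sum>a<m. \<Sum>i<2 ^ p. \<Sum>k<2 ^ p. (norm (M p i k (x a)))\<^sup>2)
      \<le> (\<Sum>a<m. 1 / (2 ^ p * 2 ^ 2 ^ p) * (\<Sum>r<2 ^ p. \<Sum>s<2 ^ 2 ^ p. (norm (dec (x a) (prod_encode (r, s))))\<^sup>2))"
    by (intro sum_mono sum_M_le)
  also have "\<dots> = 1 / (2 ^ p * 2 ^ 2 ^ p) * (\<Sum>a<m. \<Sum>r<2 ^ p. \<Sum>s<2 ^ 2 ^ p. (norm (dec (x a) (prod_encode (r, s))))\<^sup>2)"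
    by (simp add: sum_distrib_left)
  also have "(\<Sum>a<m. \<Sum>r<2 ^ p. \<Sum>s<2 ^ 2 ^ p. (norm (dec (x a) (prod_encode (r, s))))\<^sup>2)
      = (\<Sum>r<2 ^ p. \<Sum>a<m. \<Sum>s<2 ^ 2 ^ p. (norm (dec (x a) (prod_encode (r, s))))\<^sup>2)"
    by (rule sum.swap)
  also have "\<dots> = (\<Sum>r<2 ^ p. \<Sum>s<2 ^ 2 ^ p. \<Sum>a<m. (norm (dec (x a) (prod_encode (r, s))))\<^sup>2)"
    by (intro sum.cong refl sum.swap)
  also have "1 / (2 ^ p * 2 ^ 2 ^ p) * \<dots>
      \<le> 1 / (2 ^ p * 2 ^ 2 ^ p) * (\<Sum>r<(2::nat) ^ p. \<Sum>s<(2::nat) ^ 2 ^ p. (weak_norm 2 X m x)\<^sup>2)"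
    by (intro mult_left_mono sum_mono sum_eval_le assms) simp_all
  also have "\<dots> = (weak_norm 2 X m x)\<^sup>2"
    by simp
  finally show ?thesis .
qed

section \<open>Multiple summability of the trilinear form\<close>

definition \<Phi> :: "nat \<Rightarrow> ('k, 'a) tuniv list \<Rightarrow> 'k" where
  "\<Phi> p xs = (\<Sum>i<2 ^ p. \<Sum>k<2 ^ p. M p i k (xs ! 0) * dec (xs ! 1) k * dec (xs ! 2) i)"

lemma M_linear:
  "M p i k (x \<oplus>\<^bsub>X\<^esub> y) = M p i k x + M p i k y"
  "M p i k (c \<odot>\<^bsub>X\<^esub> x) = c * M p i k x"
  by (simp_all add: M_def algebra_simps sum.distrib sum_distrib_left)

lemma multilinear_form_\<Phi>: "multilinear_form [X, H, H] (\<Phi> p)"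
  unfolding multilinear_form_def list.map Ball_def listset_3
  by (auto simp: less_Suc_eq numeral_2_eq_2 \<Phi>_def M_linear algebra_simps sum.distrib sum_distrib_left)

lemma norm_M_le:
  assumes "c \<in> carrier X"
  shows "norm (M p i k c) \<le> nrm X c"
proof -
  have "norm (\<Sum>s<2 ^ 2 ^ p. chi s k * dec c (prod_encode (xor i k, s))) \<le> (\<Sum>s<(2::nat) ^ 2 ^ p. nrm X c)"
    by (rule sum_norm_le) (simp add: norm_mult norm_dec_le_linf[OF assms])
  then have "norm (M p i k c) \<le> 1 / (sqrt (2 ^ p) * 2 ^ 2 ^ p) * (2 ^ 2 ^ p * nrm X c)"
    unfolding M_def norm_mult
    by (intro mult_mono) (simp_all add: norm_divide norm_mult norm_power)
  also have "\<dots> = nrm X c / sqrt (2 ^ p)"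
    by simp
  also have "\<dots> \<le> nrm X c"
    using normed_spaceD(2)[OF linf.normed_space_S assms] by (simp add: divide_le_eq mult_le_cancel_left1)
  finally show ?thesis .
qed

text \<open>Serves continuity only, so growth in \<open>p\<close> is harmless; the uniform constant
  comes from \<open>summing_bound_\<Phi>\<close>.\<close>

lemma norm_\<Phi>_le:
  assumes "x \<in> carrier X" "y \<in> carrier H" "z \<in> carrier H"
  shows "norm (\<Phi> p [x, y, z]) \<le> 2 ^ p * 2 ^ p * (nrm X x * nrm H y * nrm H z)"
proof -
  have "norm (\<Phi> p [x, y, z]) \<le> (\<Sum>i<(2::nat) ^ p. \<Sum>k<(2::nat) ^ p. nrm X x * nrm H y * nrm H z)"
    unfolding \<Phi>_def using assms
    by (intro sum_norm_le) (auto simp: norm_mult intro!: mult_mono norm_M_le norm_dec_le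
        mult_nonneg_nonneg normed_spaceD(2)[OF linf.normed_space_S] normed_spaceD(2)[OF ell2.normed_space_S])
  then show ?thesis by simp
qed

lemma continuous_multilinear_form_\<Phi>: "continuous_multilinear_form [X, H, H] (\<Phi> p)"
proof -
  have "norm (\<Phi> p xs) \<le> 2 ^ p * 2 ^ p * (\<Prod>j<length [X, H, H]. nrm ([X, H, H] ! j) (xs ! j))"
    if xs: "xs \<in> listset (map carrier [X, H, H])" for xs
  proof -
    obtain x y z where "xs = [x, y, z]" "x \<in> carrier X" "y \<in> carrier H" "z \<in> carrier H"
      using xs unfolding list.map listset_3 by blast
    then show ?thesis
      using norm_\<Phi>_le[of x y z p] by (simp add: lessThan_Suc mult_ac)
  qed
  then show ?thesis
    using multilinear_form_\<Phi> unfolding continuous_multilinear_form_def by blast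
qed

text \<open>The variables are summed out one by one: \<open>z\<close> leaves the l_2 norm of the
  vector m(x) y, then \<open>y\<close> leaves the Hilbert-Schmidt norm of m(x), and \<open>x\<close>
  is handled by the 2-summing estimate for m.\<close>

lemma sum_\<Phi>_le:
  assumes x: "\<And>a. a < m\<^sub>0 \<Longrightarrow> x a \<in> carrier X" and y: "\<And>b. b < m\<^sub>1 \<Longrightarrow> y b \<in> carrier H"
    and z: "\<And>c. c < m\<^sub>2 \<Longrightarrow> z c \<in> carrier H"
  shows "(\<Sum>a<m\<^sub>0. \<Sum>b<m\<^sub>1. \<Sum>c<m\<^sub>2. (norm (\<Phi> p [x a, y b, z c]))\<^sup>2)
    \<le> (weak_norm 2 X m\<^sub>0 x * weak_norm 2 H m\<^sub>1 y * weak_norm 2 H m\<^sub>2 z)\<^sup>2"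
proof -
  let ?y = "(weak_norm 2 H m\<^sub>1 y)\<^sup>2" and ?z = "(weak_norm 2 H m\<^sub>2 z)\<^sup>2"
  define u where "u a b i = (\<Sum>k<2 ^ p. M p i k (x a) * dec (y b) k)" for a b i
  have "(\<Sum>b<m\<^sub>1. \<Sum>c<m\<^sub>2. (norm (\<Phi> p [x a, y b, z c]))\<^sup>2) \<le> (\<Sum>i<2 ^ p. \<Sum>k<2 ^ p. (norm (M p i k (x a)))\<^sup>2) * ?y * ?z"
    for a
  proof -
    have "(\<Sum>b<m\<^sub>1. \<Sum>c<m\<^sub>2. (norm (\<Phi> p [x a, y b, z c]))\<^sup>2)
        = (\<Sum>b<m\<^sub>1. \<Sum>c<m\<^sub>2. (norm (\<Sum>i<2 ^ p. u a b i * dec (z c) i))\<^sup>2)"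
      by (simp add: \<Phi>_def u_def sum_distrib_right)
    also have "\<dots> \<le> (\<Sum>b<m\<^sub>1. (\<Sum>i<2 ^ p. (norm (u a b i))\<^sup>2) * ?z)"
      by (intro sum_mono sum_functional_le z)
    also have "\<dots> = (\<Sum>i<2 ^ p. \<Sum>b<m\<^sub>1. (norm (u a b i))\<^sup>2) * ?z"
      by (subst sum.swap) (simp add: sum_distrib_right)
    also have "\<dots> \<le> (\<Sum>i<2 ^ p. (\<Sum>k<2 ^ p. (norm (M p i k (x a)))\<^sup>2) * ?y) * ?z"
      unfolding u_def by (intro mult_right_mono sum_mono sum_functional_le y) simp_all
    finally show ?thesis
      by (simp add: sum_distrib_right)
  qed
  then have "(\<Sum>a<m\<^sub>0. \<Sum>b<m\<^sub>1. \<Sum>c<m\<^sub>2. (norm (\<Phi> p [x a, y b, z c]))\<^sup>2)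
      \<le> (\<Sum>a<m\<^sub>0. (\<Sum>i<2 ^ p. \<Sum>k<2 ^ p. (norm (M p i k (x a)))\<^sup>2) * ?y * ?z)"
    by (rule sum_mono)
  also have "\<dots> = (\<Sum>a<m\<^sub>0. \<Sum>i<2 ^ p. \<Sum>k<2 ^ p. (norm (M p i k (x a)))\<^sup>2) * ?y * ?z"
    by (simp add: sum_distrib_right)
  also have "\<dots> \<le> (weak_norm 2 X m\<^sub>0 x)\<^sup>2 * ?y * ?z"
    by (intro mult_right_mono sum_sum_M_le x) simp_all
  finally show ?thesis
    by (simp add: power_mult_distrib)
qed

lemma summing_bound_\<Phi>: "summing_bound 2 [X, H, H] (\<Phi> p) 1"
  unfolding summing_bound_def
proof (intro allI impI)
  fix m :: "nat \<Rightarrow> nat" and x :: "nat \<Rightarrow> nat \<Rightarrow> ('k, 'a) tuniv"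
  assume A: "\<forall>j<length [X, H, H]. \<forall>i<m j. x j i \<in> carrier ([X, H, H] ! j)"
  have car: "x 0 a \<in> carrier X" if "a < m 0" for a
    using A that by (auto simp: numeral_2_eq_2)
  have carH: "x (Suc 0) a \<in> carrier H" if "a < m (Suc 0)" for a
    using A that by (auto simp: numeral_2_eq_2)
  have carH2: "x 2 a \<in> carrier H" if "a < m 2" for a
    using A that by (auto simp: numeral_2_eq_2)
  have "(\<Sum>i\<in>(\<Pi>\<^sub>E j\<in>{..<length [X, H, H]}. {..<m j}).
      (norm (\<Phi> p (map (\<lambda>j. x j (i j)) [0..<length [X, H, H]])))\<^sup>2)
      = (\<Sum>a<m 0. \<Sum>b<m 1. \<Sum>c<m 2. (norm (\<Phi> p [x 0 a, x 1 b, x 2 c]))\<^sup>2)"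
    using sum_PiE_3[of "\<lambda>a b c. (norm (\<Phi> p [x 0 a, x 1 b, x 2 c]))\<^sup>2" m] by (simp add: numeral_2_eq_2 numeral_3_eq_3)
  also have "\<dots> \<le> (weak_norm 2 X (m 0) (x 0) * weak_norm 2 H (m 1) (x 1) * weak_norm 2 H (m 2) (x 2))\<^sup>2"
    using car carH carH2 by (intro sum_\<Phi>_le) auto
  finally have "L2_set (\<lambda>i. norm (\<Phi> p (map (\<lambda>j. x j (i j)) [0..<length [X, H, H]])))
      (\<Pi>\<^sub>E j\<in>{..<length [X, H, H]}. {..<m j})
      \<le> weak_norm 2 X (m 0) (x 0) * weak_norm 2 H (m 1) (x 1) * weak_norm 2 H (m 2) (x 2)"
    by (intro L2_set_leI) (use car carH carH2 in \<open>auto intro!: mult_nonneg_nonneg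
        weak_norm_nonneg linf.normed_space_S ell2.normed_space_S\<close>)
  also have "\<dots> = 1 * (\<Prod>j<length [X, H, H]. weak_norm 2 ([X, H, H] ! j) (m j) (x j))"
    by (simp add: lessThan_Suc numeral_2_eq_2)
  finally show "(\<Sum>i\<in>(\<Pi>\<^sub>E j\<in>{..<length [X, H, H]}. {..<m j}).
      norm (\<Phi> p (map (\<lambda>j. x j (i j)) [0..<length [X, H, H]])) powr 2) powr (1 / 2)
      \<le> 1 * (\<Prod>j<length [X, H, H]. weak_norm 2 ([X, H, H] ! j) (m j) (x j))"
    unfolding powr_half_sum .
qed

lemma multiple_summing_\<Phi>: "multiple_summing 2 [X, H, H] (\<Phi> p)"
  using continuous_multilinear_form_\<Phi> summing_bound_\<Phi> zero_less_one
  unfolding multiple_summing_def by blast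

lemma summing_norm_\<Phi>_le: "summing_norm 2 [X, H, H] (\<Phi> p) \<le> 1"
  unfolding summing_norm_def
  by (rule cInf_lower) (auto simp: summing_bound_\<Phi> intro!: bdd_belowI[of _ 0])

text \<open>In \<open>M p i k (U p x (e k))\<close> the sign \<open>chi s k\<close> meets itself and
  disappears, and \<open>xor k (xor i k)\<close> returns to \<open>i\<close>, which leaves the
  coordinate \<open>dec x i\<close> divided by sqrt(d). Hence each \<open>j\<close> contributes B /
  sqrt(d), and there are d of them.\<close>

lemma sum_\<Phi>_U:
  "(\<Sum>j<2 ^ p. \<Phi> p [U p x (e j), e j, y]) = of_real (sqrt (2 ^ p)) * B p x y"
proof -
  let ?\<kappa> = "of_real (1 / (sqrt (2 ^ p) * 2 ^ 2 ^ p)) :: 'k"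
  have M: "M p i k (U p x (e k)) = ?\<kappa> * (2 ^ 2 ^ p * dec x i)" if "i < 2 ^ p" "k < 2 ^ p" for i k
  proof -
    have "dec (U p x (e k)) (prod_encode (xor i k, s)) = chi s k * dec x i" for s
    proof -
      have "dec (U p x (e k)) (prod_encode (xor i k, s))
          = (\<Sum>l<2 ^ p. dec (e k) l * chi s l * dec x (xor l (xor i k)))"
        by (rule dec_U[OF xor_less_power[OF that]])
      also have "\<dots> = (\<Sum>l<2 ^ p. if l = k then chi s k * dec x (xor k (xor i k)) else 0)"
        by (intro sum.cong refl) auto
      also have "\<dots> = chi s k * dec x i"
        using that by (simp add: xor.commute[of i k])
      finally show ?thesis .
    qed
    then show ?thesis
      by (simp add: M_def mult.assoc[symmetric])
  qed
  have "(\<Sum>j<2 ^ p. \<Phi> p [U p x (e j), e j, y])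
      = (\<Sum>j<2 ^ p. \<Sum>i<2 ^ p. \<Sum>k<2 ^ p. if k = j then M p i j (U p x (e j)) * dec y i else 0)"
    unfolding \<Phi>_def by (intro sum.cong refl) auto
  also have "\<dots> = (\<Sum>j<(2::nat) ^ p. \<Sum>i<2 ^ p. M p i j (U p x (e j)) * dec y i)"
    by (intro sum.cong refl) simp
  also have "\<dots> = (\<Sum>j<(2::nat) ^ p. \<Sum>i<2 ^ p. ?\<kappa> * (2 ^ 2 ^ p * dec x i) * dec y i)"
    by (intro sum.cong refl) (simp add: M)
  also have "\<dots> = (2 ^ p * (?\<kappa> * 2 ^ 2 ^ p)) * B p x y"
    by (simp add: B_def sum_distrib_left mult.assoc)
  also have "2 ^ p * (?\<kappa> * 2 ^ 2 ^ p) = (of_real (2 ^ p * (1 / (sqrt (2 ^ p) * 2 ^ 2 ^ p) * 2 ^ 2 ^ p)) :: 'k)"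
    by simp
  also have "2 ^ p * (1 / (sqrt (2 ^ p) * 2 ^ 2 ^ p) * 2 ^ 2 ^ p) = sqrt (2 ^ p)"
    by (simp add: real_div_sqrt)
  finally show ?thesis .
qed

section \<open>The contradiction\<close>

text \<open>The Hilbert-Schmidt norm of the form is a lower bound: it appears when the unit vectors,
  whose weak norm is at most 1, are inserted in both places.\<close>

lemma summing_norm_B_ge:
  assumes ms: "multiple_summing 2 [H, H] (\<lambda>xs. a * B p (xs ! 0) (xs ! 1))"
  shows "norm a * sqrt (2 ^ p) \<le> summing_norm 2 [H, H] (\<lambda>xs. a * B p (xs ! 0) (xs ! 1))"
  unfolding summing_norm_def
proof (rule cInf_greatest)
  show "{K. 0 < K \<and> summing_bound 2 [H, H] (\<lambda>xs. a * B p (xs ! 0) (xs ! 1)) K} \<noteq> {}"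
    using ms by (auto simp: multiple_summing_def)
  fix K assume "K \<in> {K. 0 < K \<and> summing_bound 2 [H, H] (\<lambda>xs. a * B p (xs ! 0) (xs ! 1)) K}"
  then have K: "0 < K" and sb: "summing_bound 2 [H, H] (\<lambda>xs. a * B p (xs ! 0) (xs ! 1)) K"
    by auto
  let ?P = "\<Pi>\<^sub>E j\<in>{..<2::nat}. {..<(2::nat) ^ p}"
  \<comment> \<open>The diagonal multi-indices; nothing is lost by keeping only these, since
    \<open>B\<close> vanishes on pairs of distinct unit vectors.\<close>
  let ?D = "(\<lambda>k. \<lambda>j\<in>{..<2::nat}. k) ` {..<(2::nat) ^ p}"
  have car: "\<forall>j<length [H, H]. \<forall>i<(\<lambda>_. 2 ^ p) j. (\<lambda>_. e) j i \<in> carrier ([H, H] ! j)"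
    by (auto simp: less_Suc_eq e_in_carrier)
  have Bee: "B p (e k) (e k) = 1" if "k < 2 ^ p" for k
  proof -
    have "B p (e k) (e k) = (\<Sum>i<2 ^ p. if i = k then 1 else 0)"
      unfolding B_def by (intro sum.cong refl) simp
    then show ?thesis using that by simp
  qed
  have inj: "inj_on (\<lambda>k. \<lambda>j\<in>{..<2::nat}. k) {..<(2::nat) ^ p}"
    by (rule inj_onI) (metis lessThan_iff pos2 restrict_apply')
  have "norm a * sqrt (2 ^ p) = sqrt (\<Sum>i\<in>?D. (norm (a * B p (e (i 0)) (e (i 1))))\<^sup>2)"
    by (simp add: sum.reindex[OF inj] Bee real_sqrt_mult)
  also have "\<dots> \<le> L2_set (\<lambda>i. norm (a * B p (e (i 0)) (e (i 1)))) ?P"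
    unfolding L2_set_def by (intro real_sqrt_le_mono sum_mono2) (auto simp: finite_PiE split: if_splits)
  also have "\<dots> \<le> K * (weak_norm 2 H (2 ^ p) e * weak_norm 2 H (2 ^ p) e)"
    using sb[unfolded summing_bound_def powr_half_sum, THEN spec, THEN spec, THEN mp, OF car]
    by (simp add: numeral_2_eq_2 lessThan_Suc)
  also have "\<dots> \<le> K * (1 * 1)"
    using K by (intro mult_left_mono mult_mono weak_norm_e_le weak_norm_nonneg ell2.normed_space_S
        e_in_carrier) auto
  finally show "norm a * sqrt (2 ^ p) \<le> K" by simp
qed

text \<open>The lower half of the norm equivalence on H x H, with \<open>\<delta>\<close> chosen
  before \<open>p\<close>, \<open>a\<close> and \<open>K\<close>. It is applied twice: to bound the
  norm of the diagonal tensor from above, and to the form obtained by composing with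
  \<open>R\<close>.\<close>

lemma B_norm_bound:
  assumes \<beta>: "tensor_norm \<beta>" and iso: "summing_isomorphic_dual 2 \<beta> [H, H]"
  obtains \<delta> where "0 < \<delta>"
    "\<forall>p a K. 0 \<le> K \<longrightarrow>
      (\<forall>w\<in>carrier (tensor_space \<beta> H H). norm (a * bilinear_lift (B p) w) \<le> K * \<beta> H H w) \<longrightarrow>
      \<delta> * (norm a * sqrt (2 ^ p)) \<le> K"
proof -
  let ?T = "tensor_space \<beta> H H"
  obtain \<delta> where \<delta>: "0 < \<delta>" "\<And>\<Psi> L. multiple_summing 2 [H, H] \<Psi> \<Longrightarrow> linearization \<beta> [H, H] \<Psi> L \<Longrightarrow>
      \<delta> * summing_norm 2 [H, H] \<Psi> \<le> dual_norm ?T L"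
    using conjunct2[OF iso[unfolded summing_isomorphic_dual_def ntensor_space.simps]] by blast
  have "\<delta> * (norm a * sqrt (2 ^ p)) \<le> K"
    if K: "0 \<le> K" and le: "\<And>w. w \<in> carrier ?T \<Longrightarrow> norm (a * bilinear_lift (B p) w) \<le> K * \<beta> H H w" for p a K
  proof -
    let ?\<Psi> = "\<lambda>xs. a * B p (xs ! 0) (xs ! 1)" and ?L = "\<lambda>w. a * bilinear_lift (B p) w"
    have lin: "linear_functional ?T ?L"
      using linear_functional_bilinear_lift[OF bilinear_form_B ell2.normed_space_S]
      by (simp add: linear_functional_def algebra_simps)
    then have bdd: "bounded_functional ?T ?L"
      unfolding bounded_functional_def using le by (auto simp: nrm_tensor)
    have "?L (nelem_tensor \<beta> [H, H] xs) = ?\<Psi> xs" if xs: "xs \<in> listset (map carrier [H, H])" for xs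
    proof -
      obtain x y where "xs = [x, y]" "x \<in> carrier H" "y \<in> carrier H"
        using xs unfolding list.map listset_2 by blast
      then show ?thesis
        by (simp add: elem_tensor_def bilinear_lift_tensor_of[OF bilinear_form_B])
    qed
    then have lz: "linearization \<beta> [H, H] ?\<Psi> ?L"
      using lin by (simp add: linearization_def del: listset.simps)
    have "multilinear_form [H, H] ?\<Psi>"
      unfolding multilinear_form_def list.map Ball_def listset_2
      by (auto simp: less_Suc_eq B_def algebra_simps sum.distrib sum_distrib_left)
    \<comment> \<open>The bounded lift makes the form multiple summing through the isomorphism; only
      then do the two norms become comparable.\<close>
    then have ms: "multiple_summing 2 [H, H] ?\<Psi>"
      using iso lz bdd unfolding summing_isomorphic_dual_def ntensor_space.simps by blast
    have "\<delta> * (norm a * sqrt (2 ^ p)) \<le> \<delta> * summing_norm 2 [H, H] ?\<Psi>"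
      using \<delta>(1) summing_norm_B_ge[OF ms] by simp
    also have "\<dots> \<le> dual_norm ?T ?L"
      by (rule \<delta>(2)[OF ms lz])
    also have "\<dots> \<le> K"
      by (rule dual_norm_leI[OF tensor_normD[OF \<beta> ell2.normed_space_S ell2.normed_space_S]])
        (use le K in \<open>auto simp: nrm_tensor\<close>)
    finally show ?thesis .
  qed
  with \<delta>(1) show ?thesis using that by blast
qed

text \<open>The image of \<open>diag p\<close> under \<open>U p x\<close> (x) id, that is, sqrt(d)
  times the operator R of the overview.\<close>

definition R :: "nat \<Rightarrow> ('k, 'a) tuniv \<Rightarrow> ('k, 'a) tuniv" where
  "R p x = tensor_of X H (map (\<lambda>(h, h'). (U p x h, h')) (diag p))"

lemma U_diag_in_lists:
  "x \<in> carrier H \<Longrightarrow> map (\<lambda>(h, h'). (U p x h, h')) (diag p) \<in> lists (carrier X \<times> carrier H)"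
  by (auto simp: diag_def e_in_carrier U_in_carrier)

lemma nrm_R_le:
  assumes \<beta>: "tensor_norm \<beta>" and x: "x \<in> carrier H"
  shows "\<beta> X H (R p x) \<le> \<beta> H H (tensor_of H H (diag p)) * nrm H x"
proof -
  have "op_norm H X (U p x) \<le> nrm H x"
    by (intro op_norm_leI ell2.normed_space_S nrm_U_le x normed_spaceD(2)[OF ell2.normed_space_S])
  then have "\<beta> X H (R p x) \<le> nrm H x * \<beta> H H (tensor_of H H (diag p))"
    unfolding R_def
    by (intro tensor_norm_map[OF \<beta>] ell2.normed_space_S linf.normed_space_S bounded_op_U bounded_op_id
        diag_in_lists op_norm_id_le x)
  then show ?thesis by (simp add: mult.commute)
qed

lemma bounded_op_R:
  assumes \<beta>: "tensor_norm \<beta>"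
  shows "bounded_op H (tensor_space \<beta> X H) (R p)"
  unfolding bounded_op_def
proof (intro conjI ballI allI)
  show "R p \<in> carrier H \<rightarrow> carrier (tensor_space \<beta> X H)"
    by (auto simp: R_def carrier_tensor U_diag_in_lists)
  show "\<exists>C. \<forall>x\<in>carrier H. nrm (tensor_space \<beta> X H) (R p x) \<le> C * nrm H x"
    using nrm_R_le[OF \<beta>] by (auto simp: nrm_tensor)
next
  fix x y assume x: "x \<in> carrier H" and y: "y \<in> carrier H"
  have "same_tensor X H (map (\<lambda>(h, h'). (U p (x \<oplus>\<^bsub>H\<^esub> y) h, h')) (diag p))
      (map (\<lambda>(h, h'). (U p x h, h')) (diag p) @ map (\<lambda>(h, h'). (U p y h, h')) (diag p))"
    unfolding same_tensor_def map_append sum_list_append sum_list_map_case_prod sum_list_diag U_linear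
    using x y by (simp add: bilinear_form_def linear_functional_def U_in_carrier e_in_carrier sum.distrib)
  then show "R p (x \<oplus>\<^bsub>H\<^esub> y) = R p x \<oplus>\<^bsub>tensor_space \<beta> X H\<^esub> R p y"
    unfolding R_def tensor_add[OF U_diag_in_lists[OF x] U_diag_in_lists[OF y]] by (rule tensor_of_cong)
next
  fix c x assume x: "x \<in> carrier H"
  have *: "map (\<lambda>(x, y). (c \<odot>\<^bsub>X\<^esub> x, y)) (map (\<lambda>(h, h'). (U p x h, h')) (diag p))
      = map (\<lambda>(h, h'). (U p (c \<odot>\<^bsub>H\<^esub> x) h, h')) (diag p)"
    by (auto simp: U_linear)
  show "R p (c \<odot>\<^bsub>H\<^esub> x) = c \<odot>\<^bsub>tensor_space \<beta> X H\<^esub> R p x"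
    unfolding R_def tensor_smult[OF U_diag_in_lists[OF x]] * ..
qed

text \<open>\<open>L\<close> is composed with \<open>R p\<close> (x) id, which maps H (x) H into (X
  (x) H) (x) H. The mapping property bounds this operator by the norm of the diagonal tensor, and
  \<open>sum_\<Phi>_U\<close> identifies the composition as sqrt(d) times the trace form.\<close>

lemma lift_B_bound:
  assumes \<beta>: "tensor_norm \<beta>"
    and lin: "linear_functional (tensor_space \<beta> (tensor_space \<beta> X H) H) L"
    and le: "\<And>v. v \<in> carrier (tensor_space \<beta> (tensor_space \<beta> X H) H) \<Longrightarrow>
      norm (L v) \<le> C * \<beta> (tensor_space \<beta> X H) H v"
    and C: "0 \<le> C"
    and L: "\<And>x y z. x \<in> carrier X \<Longrightarrow> y \<in> carrier H \<Longrightarrow> z \<in> carrier H \<Longrightarrow>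
      L (elem_tensor (tensor_space \<beta> X H) H (elem_tensor X H x y) z) = \<Phi> p [x, y, z]"
    and w: "w \<in> carrier (tensor_space \<beta> H H)"
  shows "norm (of_real (sqrt (2 ^ p)) * bilinear_lift (B p) w)
    \<le> C * \<beta> H H (tensor_of H H (diag p)) * \<beta> H H w"
proof -
  let ?XH = "tensor_space \<beta> X H"
  note sp = linf.normed_space_S ell2.normed_space_S
  have XH: "normed_space ?XH"
    by (rule tensor_normD[OF \<beta> sp])
  obtain l where l: "l \<in> lists (carrier H \<times> carrier H)" and wl: "w = tensor_of H H l"
    using w by (auto simp: carrier_tensor)
  define v where "v = tensor_of ?XH H (map (\<lambda>(x, y). (R p x, y)) l)"
  have R: "R p x \<in> carrier ?XH" if "x \<in> carrier H" for x
    using that by (simp add: R_def carrier_tensor U_diag_in_lists)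
  have l': "map (\<lambda>(x, y). (R p x, y)) l \<in> lists (carrier ?XH \<times> carrier H)"
    using l R by (auto simp: in_lists_conv_set)
  have LR: "L (elem_tensor ?XH H (R p x) y) = of_real (sqrt (2 ^ p)) * B p x y"
    if x: "x \<in> carrier H" and y: "y \<in> carrier H" for x y
  proof -
    have "L (elem_tensor ?XH H (R p x) y)
        = (\<Sum>(h, h')\<leftarrow>map (\<lambda>(h, h'). (U p x h, h')) (diag p). L (elem_tensor ?XH H (elem_tensor X H h h') y))"
      unfolding R_def
      by (rule linear_functional_tensor_of[OF linear_functional_elem_tensor[OF lin y] U_diag_in_lists[OF x]])
    also have "\<dots> = (\<Sum>j<2 ^ p. \<Phi> p [U p x (e j), e j, y])"
      unfolding sum_list_map_case_prod sum_list_diag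
      by (intro sum.cong refl L U_in_carrier e_in_carrier x y)
    finally show ?thesis
      by (simp only: sum_\<Phi>_U)
  qed
  have "L v = (\<Sum>(x, y)\<leftarrow>l. L (elem_tensor ?XH H (R p x) y))"
    unfolding v_def linear_functional_tensor_of[OF lin l'] sum_list_map_case_prod ..
  also have "\<dots> = (\<Sum>(x, y)\<leftarrow>l. of_real (sqrt (2 ^ p)) * B p x y)"
    using l by (intro arg_cong[of _ _ sum_list] map_cong refl) (auto simp: in_lists_conv_set LR)
  also have "\<dots> = of_real (sqrt (2 ^ p)) * bilinear_lift (B p) w"
    unfolding wl bilinear_lift_tensor_of[OF bilinear_form_B l]
    by (simp add: sum_list_const_mult[symmetric] case_prod_unfold)
  finally have Lv: "L v = of_real (sqrt (2 ^ p)) * bilinear_lift (B p) w" .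
  have d: "0 \<le> \<beta> H H (tensor_of H H (diag p))"
    using normed_spaceD(2)[OF tensor_normD[OF \<beta> sp(2) sp(2)]] diag_in_lists
    by (auto simp: carrier_tensor nrm_tensor)
  have "op_norm H ?XH (R p) \<le> \<beta> H H (tensor_of H H (diag p))"
    by (rule op_norm_leI[OF sp(2)]) (simp_all add: nrm_tensor nrm_R_le[OF \<beta>] d)
  then have v: "\<beta> ?XH H v \<le> \<beta> H H (tensor_of H H (diag p)) * \<beta> H H w"
    unfolding v_def wl
    by (intro tensor_norm_map[OF \<beta>] sp XH bounded_op_R[OF \<beta>] bounded_op_id l op_norm_id_le)
  have "norm (L v) \<le> C * \<beta> ?XH H v"
    using l' by (intro le) (auto simp: v_def carrier_tensor)
  also have "\<dots> \<le> C * (\<beta> H H (tensor_of H H (diag p)) * \<beta> H H w)"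
    by (rule mult_left_mono[OF v C])
  finally show ?thesis
    by (simp only: Lv mult.assoc)
qed

lemma not_summing_ideal_dual_to:
  fixes \<beta> :: "('k, 'a) norm_assignment"
  assumes \<beta>: "tensor_norm \<beta>"
  shows "\<not> summing_ideal_dual_to 2 \<beta>"
proof
  assume dual: "summing_ideal_dual_to 2 \<beta>"
  let ?XH = "tensor_space \<beta> X H"
  note sp = linf.normed_space_S ell2.normed_space_S
  have iso2: "summing_isomorphic_dual 2 \<beta> [H, H]" and iso3: "summing_isomorphic_dual 2 \<beta> [X, H, H]"
    using dual linf.banach_space_S ell2.banach_space_S by (auto simp: summing_ideal_dual_to_def)
  obtain \<delta> where \<delta>: "0 < \<delta>" and "\<forall>p a K. 0 \<le> K \<longrightarrow>
      (\<forall>w\<in>carrier (tensor_space \<beta> H H). norm (a * bilinear_lift (B p) w) \<le> K * \<beta> H H w) \<longrightarrow>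
      \<delta> * (norm a * sqrt (2 ^ p)) \<le> K"
    by (rule B_norm_bound[OF \<beta> iso2])
  note \<delta>_le = this(2)[rule_format]
  obtain C where C: "0 < C" "\<And>\<Psi> L. multiple_summing 2 [X, H, H] \<Psi> \<Longrightarrow> linearization \<beta> [X, H, H] \<Psi> L \<Longrightarrow>
      dual_norm (tensor_space \<beta> ?XH H) L \<le> C * summing_norm 2 [X, H, H] \<Psi>"
    using conjunct2[OF iso3[unfolded summing_isomorphic_dual_def ntensor_space.simps]] by blast
  \<comment> \<open>With d = 2^p, the unknown norm \<open>t\<close> of the diagonal tensor is
    squeezed between \<open>\<delta> * t\<close> \<le> sqrt(d), from H x H, and
    \<open>\<delta>\<close> d \<le> \<open>C * t\<close>, from X x H x H. Eliminating it bounds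
    sqrt(d).\<close>
  have bound: "\<delta>\<^sup>2 * sqrt (2 ^ p) \<le> C" for p
  proof -
    define t where "t = \<beta> H H (tensor_of H H (diag p))"
    have t: "0 \<le> t"
      using normed_spaceD(2)[OF tensor_normD[OF \<beta> sp(2) sp(2)]] diag_in_lists
      by (auto simp: carrier_tensor nrm_tensor t_def)
    have t_le: "\<delta> * t \<le> sqrt (2 ^ p)"
    proof -
      \<comment> \<open>By \<open>norm_lift_B_le\<close> the scalar t / 2^p is exactly the one for
        which the scaled trace form has bound 1.\<close>
      have "\<delta> * (norm (of_real (t / 2 ^ p) :: 'k) * sqrt (2 ^ p)) \<le> 1"
      proof (rule \<delta>_le)
        fix w assume "w \<in> carrier (tensor_space \<beta> H H)"
        from norm_lift_B_le[OF \<beta> this, of p]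
        show "norm (of_real (t / 2 ^ p) * bilinear_lift (B p) w) \<le> 1 * \<beta> H H w"
          using t by (simp add: norm_mult norm_divide norm_power t_def field_simps)
      qed simp
      then have "\<delta> * (t / 2 ^ p * sqrt (2 ^ p)) \<le> 1"
        using t by (simp only: norm_of_real) simp
      then have "(\<delta> * t) * sqrt (2 ^ p) \<le> sqrt (2 ^ p) * sqrt (2 ^ p)"
        by (simp add: field_simps)
      then show ?thesis
        by (rule mult_right_le_imp_le) simp
    qed
    obtain L where L: "linearization \<beta> [X, H, H] (\<Phi> p) L" "bounded_functional (tensor_space \<beta> ?XH H) L"
      using iso3 multilinear_form_\<Phi> multiple_summing_\<Phi>
      unfolding summing_isomorphic_dual_def ntensor_space.simps by blast
    have nsp: "normed_space (tensor_space \<beta> ?XH H)"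
      by (intro tensor_normD[OF \<beta>] sp)
    have "dual_norm (tensor_space \<beta> ?XH H) L \<le> C * summing_norm 2 [X, H, H] (\<Phi> p)"
      by (rule C(2)[OF multiple_summing_\<Phi> L(1)])
    also have "\<dots> \<le> C * 1"
      using C(1) summing_norm_\<Phi>_le by (intro mult_left_mono) auto
    finally have dn: "dual_norm (tensor_space \<beta> ?XH H) L \<le> C"
      by simp
    have "norm (of_real (sqrt (2 ^ p)) * bilinear_lift (B p) w) \<le> C * t * \<beta> H H w"
      if "w \<in> carrier (tensor_space \<beta> H H)" for w
      unfolding t_def
    proof (rule lift_B_bound[OF \<beta> _ _ _ _ that])
      show "linear_functional (tensor_space \<beta> ?XH H) L"
        using L(2) by (simp add: bounded_functional_def)
      show "0 \<le> C" using C(1) by simp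
      show "norm (L v) \<le> C * \<beta> ?XH H v" if v: "v \<in> carrier (tensor_space \<beta> ?XH H)" for v
      proof -
        have "norm (L v) \<le> dual_norm (tensor_space \<beta> ?XH H) L * \<beta> ?XH H v"
          using norm_le_dual_norm[OF nsp L(2) v] by (simp add: nrm_tensor)
        also have "\<dots> \<le> C * \<beta> ?XH H v"
          using dn normed_spaceD(2)[OF nsp v] by (intro mult_right_mono) (simp_all add: nrm_tensor)
        finally show ?thesis .
      qed
      show "L (elem_tensor ?XH H (elem_tensor X H x y) z) = \<Phi> p [x, y, z]"
        if "x \<in> carrier X" "y \<in> carrier H" "z \<in> carrier H" for x y z
      proof -
        have "[x, y, z] \<in> listset (map carrier [X, H, H])"
          using that by (simp add: set_Cons_def)
        then show ?thesis
          using L(1) by (auto simp: linearization_def simp del: listset.simps)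
      qed
    qed
    \<comment> \<open>One factor sqrt(d) is the coefficient from \<open>sum_\<Phi>_U\<close>, the
      other the Hilbert-Schmidt norm of \<open>B p\<close>; against the bound \<open>C * t\<close>,
      and \<open>t\<close> of order at most sqrt(d), this is too large.\<close>
    then have "\<delta> * (norm (of_real (sqrt (2 ^ p)) :: 'k) * sqrt (2 ^ p)) \<le> C * t"
      using C(1) t by (intro \<delta>_le) simp_all
    then have "\<delta> * (sqrt (2 ^ p) * sqrt (2 ^ p)) \<le> C * t"
      by (simp only: norm_of_real) simp
    then have "\<delta> * (\<delta> * (sqrt (2 ^ p) * sqrt (2 ^ p))) \<le> \<delta> * (C * t)"
      using \<delta> by (intro mult_left_mono) auto
    also have "\<dots> \<le> C * sqrt (2 ^ p)"
      using mult_left_mono[OF t_le, of C] C(1) by (simp add: mult_ac)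
    finally have "(\<delta>\<^sup>2 * sqrt (2 ^ p)) * sqrt (2 ^ p) \<le> C * sqrt (2 ^ p)"
      by (simp add: power2_eq_square mult_ac)
    then show ?thesis
      by (rule mult_right_le_imp_le) simp
  qed
  obtain p where "C\<^sup>2 / \<delta> ^ 4 < 2 ^ p"
    using real_arch_pow[of 2] by auto
  then have "C\<^sup>2 < \<delta> ^ 4 * 2 ^ p"
    using \<delta> by (simp add: divide_less_eq mult.commute)
  moreover have "(\<delta>\<^sup>2 * sqrt (2 ^ p))\<^sup>2 \<le> C\<^sup>2"
    using bound[of p] \<delta> by (intro power_mono) auto
  ultimately show False
    by (simp add: power_mult_distrib)
qed

end

text \<open>The atoms \<open>'a\<close> are arbitrary and may be few, so the sequence spaces are
  housed among the scalars, of which there are at least continuum many over both fields.\<close>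

lemma inj_Scalar_of_real:
  fixes f :: "(nat \<Rightarrow> 'k::real_normed_field) \<Rightarrow> real"
  assumes "inj f"
  shows "inj (\<lambda>u. Scalar (of_real (f u) :: 'k) :: ('k, 'a) tuniv)"
  using assms by (simp add: inj_def)

theorem proposition2p3:
  shows "\<not> (\<exists>\<beta> :: (real, 'a) norm_assignment.
              tensor_norm \<beta> \<and> associative \<beta> \<and> summing_ideal_dual_to 2 \<beta>)
       \<and> \<not> (\<exists>\<beta> :: (complex, 'a) norm_assignment.
              tensor_norm \<beta> \<and> associative \<beta> \<and> summing_ideal_dual_to 2 \<beta>)"
proof -
  obtain f :: "(nat \<Rightarrow> real) \<Rightarrow> real" and g :: "(nat \<Rightarrow> complex) \<Rightarrow> real" where "inj f" "inj g"
    using ex_inj_real_seq ex_inj_complex_seq by blast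
  then interpret re: tensor_universe "\<lambda>u. Scalar (of_real (f u)) :: (real, 'a) tuniv"
    + co: tensor_universe "\<lambda>u. Scalar (of_real (g u)) :: (complex, 'a) tuniv"
    by (simp_all only: tensor_universe_def inj_Scalar_of_real)
  show ?thesis
    using re.not_summing_ideal_dual_to co.not_summing_ideal_dual_to by blast
qed

end
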